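(* A CAT(0) space $X$ is hyperbolic if and only if there exists $L_0$ such that for each $L\ge L_0$, the identity map is a quasiisometry between each pair among $X$, $X_L$, and $X_D$.
   Context: **Curtains.** Let $(X,d)$ be a CAT(0) space. A geodesic is an isometric embedding $\alpha:I\to X$ of an interval $I\subset\mathbb R$, and $\pi_\alpha:X\to\alpha$ is closest-point projection. For $r$ with $[r-\frac12,r+\frac12]$ in the interior of $I$, the curtain dual to $\alpha$ at $r$ is $h=h_{\alpha,r}=\pi_\alpha^{-1}(\alpha[r-\frac12,r+\frac12])$. Its halfspaces are $h^-=\pi_\alpha^{-1}\alpha(I\cap(-\infty,r-\frac12))$ and $h^+=\pi_\alpha^{-1}\alpha(I\cap(r+\frac12,\infty))$. The curtain $h$ separates $A,B\subset X$ if one of them is contained in $h^-$ and the other in $h^+$. A chain is a set of pairwise disjoint curtains $\{h_i\}$, indexed by consecutive integers, such that $h_i$ separates $h_{i-1}$ from $h_{i+1}$ for all $i$; it separates $A$ from $B$ if every $h_i$ does. **$L$-separation and $X_L$.** For $L\in\mathbb N=\{0,1,2,\dots\}$, disjoint curtains $h,h'$ are $L$-separated if every chain all of whose elements meet both $h$ and $h'$ has cardinality at most $L$. An $L$-chain is a chain whose elements are pairwise $L$-separated. Set $d_L(x,x)=0$ and, for $x\neq y$, $d_L(x,y)=1+\max\{|c| : c \text{ is an } L\text{-chain separating } x \text{ from } y\}$. This is a metric, and $X_L=(X,d_L)$. **Curtain model.** Fix numbers $\lambda_L\in(0,1)$, $L\ge1$, with $\sum\lambda_L<\sum L\lambda_L<\sum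 L^2\lambda_L=\Lambda<\infty$. Put $D(x,y)=\sum_{L=1}^\infty\lambda_L d_L(x,y)$. The curtain model is $X_D=(X,D)$. The spaces $X$, $X_L$, $X_D$ have the same underlying set. *)

theory Defs
  imports "HOL-Analysis.Analysis"
begin

section \<open>Geodesics, CAT(0) spaces, hyperbolicity and quasi-isometries\<close>

text \<open>
  A space is given by a carrier \<open>M\<close> and a distance function \<open>d\<close>, as in the locale
  \<^locale>\<open>Metric_space\<close>, so that several distances on one underlying set can be compared.
\<close>

definition geodesic :: "'a set \<Rightarrow> ('a \<Rightarrow> 'a \<Rightarrow> real) \<Rightarrow> real set \<Rightarrow> (real \<Rightarrow> 'a) \<Rightarrow> bool" where
  "geodesic M d I \<alpha> \<longleftrightarrow>
     is_interval I \<and> \<alpha> ` I \<subseteq> M \<and> (\<forall>s\<in>I. \<forall>t\<in>I. d (\<alpha> s) (\<alpha> t) = \<bar>s - t\<bar>)"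

definition geodesic_segment :: "'a set \<Rightarrow> ('a \<Rightarrow> 'a \<Rightarrow> real) \<Rightarrow> 'a \<Rightarrow> 'a \<Rightarrow> 'a set \<Rightarrow> bool" where
  "geodesic_segment M d x y S \<longleftrightarrow>
     (\<exists>\<alpha>. geodesic M d {0..d x y} \<alpha> \<and> \<alpha> 0 = x \<and> \<alpha> (d x y) = y \<and> S = \<alpha> ` {0..d x y})"

definition geodesic_space :: "'a set \<Rightarrow> ('a \<Rightarrow> 'a \<Rightarrow> real) \<Rightarrow> bool" where
  "geodesic_space M d \<longleftrightarrow> (\<forall>x\<in>M. \<forall>y\<in>M. \<exists>S. geodesic_segment M d x y S)"

text \<open>
  The points \<open>p'\<close>, \<open>q'\<close>, \<open>r'\<close> span a comparison triangle in the Euclidean plane, and \<open>x'\<close>, \<open>y'\<close>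
  are the comparison points of \<open>x\<close>, \<open>y\<close>.  Any two distinct sides of a triangle share a vertex, so
  up to relabelling the vertices it is enough to compare points on \<open>[p,q]\<close> and \<open>[p,r]\<close>; for two
  points on one side the inequality is an equality.  No completeness is required.
\<close>

definition CAT0 :: "'a set \<Rightarrow> ('a \<Rightarrow> 'a \<Rightarrow> real) \<Rightarrow> bool" where
  "CAT0 M d \<longleftrightarrow>
     Metric_space M d \<and> geodesic_space M d \<and>
     (\<forall>p\<in>M. \<forall>q\<in>M. \<forall>r\<in>M. \<forall>S T U.
        geodesic_segment M d p q S \<and> geodesic_segment M d p r T \<and> geodesic_segment M d q r U \<longrightarrow>
        (\<forall>p' q' r' :: real^2.
           dist p' q' = d p q \<and> dist p' r' = d p r \<and> dist q' r' = d q r \<longrightarrow>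
           (\<forall>x\<in>S. \<forall>y\<in>T. \<forall>x'\<in>closed_segment p' q'. \<forall>y'\<in>closed_segment p' r'.
              dist p' x' = d p x \<and> dist p' y' = d p y \<longrightarrow> d x y \<le> dist x' y')))"

text \<open>Gromov hyperbolicity of a geodesic space, in the form of uniformly slim triangles.\<close>

definition hyperbolic_space :: "'a set \<Rightarrow> ('a \<Rightarrow> 'a \<Rightarrow> real) \<Rightarrow> bool" where
  "hyperbolic_space M d \<longleftrightarrow>
     (\<exists>\<delta>\<ge>0. \<forall>p\<in>M. \<forall>q\<in>M. \<forall>r\<in>M. \<forall>S T U.
        geodesic_segment M d p q S \<and> geodesic_segment M d p r T \<and> geodesic_segment M d q r U \<longrightarrow>
        (\<forall>x\<in>S. \<exists>y\<in>T \<union> U. d x y \<le> \<delta>))"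

definition quasi_isometry ::
  "'a set \<Rightarrow> ('a \<Rightarrow> 'a \<Rightarrow> real) \<Rightarrow> 'b set \<Rightarrow> ('b \<Rightarrow> 'b \<Rightarrow> real) \<Rightarrow> ('a \<Rightarrow> 'b) \<Rightarrow> bool" where
  "quasi_isometry M d N e f \<longleftrightarrow>
     f ` M \<subseteq> N \<and>
     (\<exists>K\<ge>1. \<exists>C\<ge>0.
        (\<forall>x\<in>M. \<forall>y\<in>M. d x y / K - C \<le> e (f x) (f y) \<and> e (f x) (f y) \<le> K * d x y + C) \<and>
        (\<forall>z\<in>N. \<exists>x\<in>M. e (f x) z \<le> C))"


section \<open>Curtains\<close>

text \<open>The analogue of \<^const>\<open>closest_point\<close> for a distance function on a carrier set.\<close>

definition proj_onto :: "('a \<Rightarrow> 'a \<Rightarrow> real) \<Rightarrow> 'a set \<Rightarrow> 'a \<Rightarrow> 'a" where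
  "proj_onto d S x = (SOME p. p \<in> S \<and> (\<forall>q\<in>S. d x p \<le> d x q))"

definition proj_preimage ::
  "'a set \<Rightarrow> ('a \<Rightarrow> 'a \<Rightarrow> real) \<Rightarrow> real set \<Rightarrow> (real \<Rightarrow> 'a) \<Rightarrow> real set \<Rightarrow> 'a set" where
  "proj_preimage M d I \<alpha> J = {x \<in> M. proj_onto d (\<alpha> ` I) x \<in> \<alpha> ` J}"

definition curtain_at :: "'a set \<Rightarrow> ('a \<Rightarrow> 'a \<Rightarrow> real) \<Rightarrow> real set \<Rightarrow> (real \<Rightarrow> 'a) \<Rightarrow> real \<Rightarrow> 'a set" where
  "curtain_at M d I \<alpha> r = proj_preimage M d I \<alpha> {r - 1/2..r + 1/2}"

definition halfspace_minus ::
  "'a set \<Rightarrow> ('a \<Rightarrow> 'a \<Rightarrow> real) \<Rightarrow> real set \<Rightarrow> (real \<Rightarrow> 'a) \<Rightarrow> real \<Rightarrow> 'a set" where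
  "halfspace_minus M d I \<alpha> r = proj_preimage M d I \<alpha> (I \<inter> {..<r - 1/2})"

definition halfspace_plus ::
  "'a set \<Rightarrow> ('a \<Rightarrow> 'a \<Rightarrow> real) \<Rightarrow> real set \<Rightarrow> (real \<Rightarrow> 'a) \<Rightarrow> real \<Rightarrow> 'a set" where
  "halfspace_plus M d I \<alpha> r = proj_preimage M d I \<alpha> (I \<inter> {r + 1/2<..})"

text \<open>
  The interval \<open>I\<close> is closed (possibly unbounded): then the image of \<open>\<alpha>\<close> is complete and the
  closest-point projection is defined on the whole space.
\<close>

definition dual_at ::
  "'a set \<Rightarrow> ('a \<Rightarrow> 'a \<Rightarrow> real) \<Rightarrow> 'a set \<Rightarrow> real set \<Rightarrow> (real \<Rightarrow> 'a) \<Rightarrow> real \<Rightarrow> bool" where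
  "dual_at M d h I \<alpha> r \<longleftrightarrow>
     closed I \<and> geodesic M d I \<alpha> \<and> {r - 1/2..r + 1/2} \<subseteq> interior I \<and> h = curtain_at M d I \<alpha> r"

definition curtain :: "'a set \<Rightarrow> ('a \<Rightarrow> 'a \<Rightarrow> real) \<Rightarrow> 'a set \<Rightarrow> bool" where
  "curtain M d h \<longleftrightarrow> (\<exists>I \<alpha> r. dual_at M d h I \<alpha> r)"

text \<open>
  In a CAT(0) space the two halfspaces of a curtain \<open>h\<close> are the connected components of \<open>M - h\<close>, so
  the unordered pair of halfspaces, and hence separation, does not depend on the geodesic to which
  \<open>h\<close> is dual.
\<close>

definition separates :: "'a set \<Rightarrow> ('a \<Rightarrow> 'a \<Rightarrow> real) \<Rightarrow> 'a set \<Rightarrow> 'a set \<Rightarrow> 'a set \<Rightarrow> bool" where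
  "separates M d h A B \<longleftrightarrow>
     (\<exists>I \<alpha> r. dual_at M d h I \<alpha> r \<and>
        (A \<subseteq> halfspace_minus M d I \<alpha> r \<and> B \<subseteq> halfspace_plus M d I \<alpha> r \<or>
         A \<subseteq> halfspace_plus M d I \<alpha> r \<and> B \<subseteq> halfspace_minus M d I \<alpha> r))"

text \<open>
  The index set \<open>J\<close> consists of consecutive integers; it may be empty or infinite.  Since curtains
  are nonempty, disjointness makes the indexing injective.
\<close>

definition curtain_chain :: "'a set \<Rightarrow> ('a \<Rightarrow> 'a \<Rightarrow> real) \<Rightarrow> 'a set set \<Rightarrow> bool" where
  "curtain_chain M d c \<longleftrightarrow>
     (\<exists>(J :: int set) h.
        (\<forall>i\<in>J. \<forall>k\<in>J. {i..k} \<subseteq> J) \<and> c = h ` J \<and>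
        (\<forall>i\<in>J. curtain M d (h i)) \<and> disjoint_family_on h J \<and>
        (\<forall>i. i - 1 \<in> J \<and> i \<in> J \<and> i + 1 \<in> J \<longrightarrow> separates M d (h i) (h (i - 1)) (h (i + 1))))"

definition chain_separates ::
  "'a set \<Rightarrow> ('a \<Rightarrow> 'a \<Rightarrow> real) \<Rightarrow> 'a set set \<Rightarrow> 'a set \<Rightarrow> 'a set \<Rightarrow> bool" where
  "chain_separates M d c A B \<longleftrightarrow> (\<forall>h\<in>c. separates M d h A B)"

definition L_separated ::
  "'a set \<Rightarrow> ('a \<Rightarrow> 'a \<Rightarrow> real) \<Rightarrow> nat \<Rightarrow> 'a set \<Rightarrow> 'a set \<Rightarrow> bool" where
  "L_separated M d L h h' \<longleftrightarrow>
     curtain M d h \<and> curtain M d h' \<and> h \<inter> h' = {} \<and>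
     (\<forall>c. curtain_chain M d c \<and> (\<forall>k\<in>c. k \<inter> h \<noteq> {} \<and> k \<inter> h' \<noteq> {}) \<longrightarrow> finite c \<and> card c \<le> L)"

definition L_chain :: "'a set \<Rightarrow> ('a \<Rightarrow> 'a \<Rightarrow> real) \<Rightarrow> nat \<Rightarrow> 'a set set \<Rightarrow> bool" where
  "L_chain M d L c \<longleftrightarrow> curtain_chain M d c \<and> pairwise (L_separated M d L) c"


section \<open>The metrics \<open>d\<^sub>L\<close> and the curtain model\<close>

text \<open>
  In a CAT(0) space the halfspaces of a curtain are at distance at least 1 from each other, so chains
  separating \<open>x\<close> from \<open>y\<close> are finite with cardinality bounded in terms of \<open>d x y\<close>, and the maximum
  (over a set containing 0, from the empty chain) exists.
\<close>

definition dist_L :: "'a set \<Rightarrow> ('a \<Rightarrow> 'a \<Rightarrow> real) \<Rightarrow> nat \<Rightarrow> 'a \<Rightarrow> 'a \<Rightarrow> real" where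
  "dist_L M d L x y =
     (if x = y then 0
      else 1 + real (Max {card c | c. L_chain M d L c \<and> chain_separates M d c {x} {y}}))"

text \<open>
  Weights are indexed by \<open>L \<ge> 1\<close>; the series below are shifted by one and the value \<open>lam 0\<close> is never
  used.  Summability of the first two series follows from that of the third.
\<close>

definition curtain_weights :: "(nat \<Rightarrow> real) \<Rightarrow> bool" where
  "curtain_weights lam \<longleftrightarrow>
     (\<forall>L\<ge>1. 0 < lam L \<and> lam L < 1) \<and>
     summable (\<lambda>n. real (Suc n) ^ 2 * lam (Suc n)) \<and>
     (\<Sum>n. lam (Suc n)) < (\<Sum>n. real (Suc n) * lam (Suc n)) \<and>
     (\<Sum>n. real (Suc n) * lam (Suc n)) < (\<Sum>n. real (Suc n) ^ 2 * lam (Suc n))"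

definition curtain_model_dist ::
  "'a set \<Rightarrow> ('a \<Rightarrow> 'a \<Rightarrow> real) \<Rightarrow> (nat \<Rightarrow> real) \<Rightarrow> 'a \<Rightarrow> 'a \<Rightarrow> real" where
  "curtain_model_dist M d lam x y = (\<Sum>n. lam (Suc n) * dist_L M d (Suc n) x y)"

end

theory Submission
  imports Defs
begin

text \<open>
  A curtain is the preimage of an interval of length 1 under a nonexpansive function, the
  coordinate of the projection to a geodesic. So a geodesic needs at least unit length to cross a curtain,
  and at most \<open>d x y + 1\<close> disjoint curtains separate \<open>x\<close> from \<open>y\<close> (\<open>card_separating_le\<close>). This gives
  \<open>d\<^sub>L \<le> d + 2\<close> for every \<open>L\<close>, and with it an upper bound for \<open>D\<close> by a multiple of \<open>d + 2\<close>. The content of the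
  theorem is therefore that hyperbolicity is equivalent to a linear lower bound for \<open>d\<^sub>L\<close> in terms of \<open>d\<close>.

  If triangles are \<open>\<delta>\<close>-slim, two curtains dual to one geodesic at distance at least \<open>8 \<delta> + 2\<close> are
  \<open>L\<close>-separated for every large \<open>L\<close>: a curtain that meets both contains a path between them that runs along a
  pole, and slimness forces this path to pass within \<open>4 \<delta>\<close> of the midpoint of the geodesic between the two
  positions. So a chain all of whose members meet both curtains visits one ball with each of them, and
  counting bounds its length (\<open>far_dual_curtains_L_separated\<close>). Evenly spaced curtains along a geodesic then form an
  \<open>L\<close>-chain whose size is proportional to the length.

  Conversely, \<open>L\<close>-separated curtains are bottlenecks: if three consecutive members of an \<open>L\<close>-chain separate the
  initial points of two geodesics from their end points, every point of one geodesic in the middle curtain is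
  within \<open>2 L + 4\<close> of the other geodesic (\<open>bottleneck\<close>). A lower bound for \<open>d\<^sub>L\<close>
  provides a long \<open>L\<close>-chain across every long piece of a side of a triangle. The bottleneck implies that all but boundedly many of its members separate the
  two end points of that side (\<open>nested_no_backtracking\<close>). The third vertex leaves three consecutive members that
  separate one of these end points from the other two vertices, and applying the bottleneck to them
  makes the triangle slim (\<open>hyperbolic_if_dist_L_large\<close>).

  The geometry rests on one inequality, the convexity of the squared distance along geodesics
  (\<open>geodesic_convexity\<close>). It yields nearest points on geodesics, a Pythagorean inequality at them, and the fact that
  the projection does not increase distances.
\<close>

section \<open>Geodesics\<close>

lemma geodesic_dist:
  "geodesic M d I \<alpha> \<Longrightarrow> s \<in> I \<Longrightarrow> t \<in> I \<Longrightarrow> d (\<alpha> s) (\<alpha> t) = \<bar>s - t\<bar>"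
  by (simp add: geodesic_def)

lemma geodesic_in: "geodesic M d I \<alpha> \<Longrightarrow> s \<in> I \<Longrightarrow> \<alpha> s \<in> M"
  by (auto simp: geodesic_def)

lemma geodesic_between:
  assumes "geodesic M d I \<alpha>" "a \<in> I" "b \<in> I" "a \<le> s" "s \<le> b"
  shows "s \<in> I"
  using assms unfolding geodesic_def is_interval_1 by blast

lemma geodesic_restrict:
  assumes "geodesic M d I \<alpha>" "J \<subseteq> I" "is_interval J"
  shows "geodesic M d J \<alpha>"
  using assms unfolding geodesic_def by blast

lemma geodesic_shift:
  assumes "geodesic M d {a..b} \<alpha>"
  shows "geodesic M d {0..b - a} (\<lambda>s. \<alpha> (a + s))"
  using assms unfolding geodesic_def by (auto simp: is_interval_cc image_subset_iff)

lemma geodesic_reverse: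
  assumes "geodesic M d {0..l} \<alpha>"
  shows "geodesic M d {0..l} (\<lambda>s. \<alpha> (l - s))"
  using assms unfolding geodesic_def by (auto simp: is_interval_cc image_subset_iff)

lemma geodesic_segment_subset:
  "geodesic_segment M d x y S \<Longrightarrow> S \<subseteq> M"
  by (auto simp: geodesic_segment_def geodesic_def)

definition nearest :: "('a \<Rightarrow> 'a \<Rightarrow> real) \<Rightarrow> 'a set \<Rightarrow> 'a \<Rightarrow> 'a \<Rightarrow> bool" where
  "nearest d S x p \<longleftrightarrow> p \<in> S \<and> (\<forall>q\<in>S. d x p \<le> d x q)"

section \<open>Convexity of the distance in CAT(0) spaces\<close>

locale CAT0_space =
  fixes M :: "'a set" and d :: "'a \<Rightarrow> 'a \<Rightarrow> real"
  assumes CAT0: "CAT0 M d"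

sublocale CAT0_space \<subseteq> Metric_space M d
  by (rule CAT0[unfolded CAT0_def, THEN conjunct1])

context CAT0_space
begin

lemma geodesic_exists:
  assumes "x \<in> M" "y \<in> M"
  obtains \<gamma> where "geodesic M d {0..d x y} \<gamma>" "\<gamma> 0 = x" "\<gamma> (d x y) = y"
    "geodesic_segment M d x y (\<gamma> ` {0..d x y})"
proof -
  have "geodesic_space M d"
    by (rule CAT0[unfolded CAT0_def, THEN conjunct2, THEN conjunct1])
  then obtain S where "geodesic_segment M d x y S"
    using assms unfolding geodesic_space_def by blast
  then show ?thesis
    using that unfolding geodesic_segment_def by blast
qed

lemma geodesic_segmentI:
  assumes "geodesic M d {0..l} \<gamma>" "0 \<le> l" "x = \<gamma> 0" "y = \<gamma> l"
  shows "geodesic_segment M d x y (\<gamma> ` {0..l})" "d x y = l"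
proof -
  show "d x y = l"
    using geodesic_dist[OF assms(1), of 0 l] assms by simp
  then show "geodesic_segment M d x y (\<gamma> ` {0..l})"
    unfolding geodesic_segment_def using assms by (intro exI[of _ \<gamma>]) simp
qed

lemma geodesic_segment_commute:
  assumes "geodesic_segment M d x y S"
  shows "geodesic_segment M d y x S"
proof -
  obtain \<alpha> where \<alpha>: "geodesic M d {0..d x y} \<alpha>" "\<alpha> 0 = x" "\<alpha> (d x y) = y" "S = \<alpha> ` {0..d x y}"
    using assms unfolding geodesic_segment_def by blast
  let ?\<beta> = "\<lambda>s. \<alpha> (d x y - s)"
  have "S = ?\<beta> ` {0..d x y}"
    unfolding \<alpha>(4)
  proof safe
    fix s assume "s \<in> {0..d x y}"
    then show "\<alpha> s \<in> ?\<beta> ` {0..d x y}"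
      by (intro image_eqI[of _ _ "d x y - s"]) auto
  next
    fix s assume "s \<in> {0..d x y}"
    then show "\<alpha> (d x y - s) \<in> \<alpha> ` {0..d x y}" by auto
  qed
  then show ?thesis
    using geodesic_segmentI(1)[OF geodesic_reverse[OF \<alpha>(1)], of y x] \<alpha> by simp
qed

text \<open>
  In the comparison triangle the distance from a vertex to a point of the opposite side is given by
  Stewart's formula. Apart from the existence of geodesics, the later arguments use the CAT(0) condition
  only through this inequality; it is multiplied by \<open>l\<close> to stay polynomial.
\<close>

lemma comparison_inequality:
  assumes \<gamma>: "geodesic M d {0..l} \<gamma>" and l: "0 < l" and x: "x \<in> M" and t: "0 \<le> t" "t \<le> l"
  shows "l * (d x (\<gamma> t))\<^sup>2
    \<le> (l - t) * (d x (\<gamma> 0))\<^sup>2 + t * (d x (\<gamma> l))\<^sup>2 - t * (l - t) * l"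
proof -
  define p q where "p = \<gamma> 0" and "q = \<gamma> l"
  have M: "p \<in> M" "q \<in> M" "\<gamma> t \<in> M"
    using geodesic_in[OF \<gamma>] l t by (auto simp: p_def q_def)
  have pq: "d p q = l" and S: "geodesic_segment M d p q (\<gamma> ` {0..l})"
    using geodesic_segmentI[OF \<gamma>, of p q] l by (auto simp: p_def q_def)
  obtain \<tau> where \<tau>: "\<tau> (d p x) = x" "geodesic_segment M d p x (\<tau> ` {0..d p x})"
    using geodesic_exists[OF M(1) x] by blast
  define T where "T = \<tau> ` {0..d p x}"
  have T: "geodesic_segment M d p x T" "x \<in> T"
    using \<tau> by (auto simp: T_def intro!: image_eqI[of x \<tau> "d p x"])
  obtain U where U: "geodesic_segment M d q x U"
    using geodesic_exists[OF M(2) x] by blast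
  define A B where "A = d p x" and "B = d q x"
  have AB: "0 \<le> A" "0 \<le> B" "l \<le> A + B" "A \<le> l + B" "B \<le> l + A"
    using triangle[OF M(1) x M(2)] triangle[OF M(1,2) x] triangle[OF M(2) M(1) x]
      commute[of p q] commute[of q x] pq
    by (auto simp: A_def B_def)
  \<comment> \<open>The comparison triangle has vertices \<open>(0,0)\<close>, \<open>(l,0)\<close> and \<open>(a,b)\<close>.\<close>
  define a where "a = (A\<^sup>2 + l\<^sup>2 - B\<^sup>2) / (2 * l)"
  have a2: "2 * l * a = A\<^sup>2 + l\<^sup>2 - B\<^sup>2"
    using l by (simp add: a_def)
  have "a\<^sup>2 \<le> A\<^sup>2"
  proof -
    have "(l - A)\<^sup>2 \<le> B\<^sup>2"
      by (rule abs_le_square_iff[THEN iffD1]) (use AB in auto)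
    then have "2 * l * a \<le> 2 * l * A"
      unfolding a2 by (simp add: power2_eq_square algebra_simps)
    then have "a \<le> A" using l by simp
    have "B\<^sup>2 \<le> (l + A)\<^sup>2"
      by (rule abs_le_square_iff[THEN iffD1]) (use AB l in auto)
    then have "2 * l * (- A) \<le> 2 * l * a"
      unfolding a2 by (simp add: power2_eq_square algebra_simps)
    then have "- A \<le> a" using l
      using mult_le_cancel_left_pos[of "2*l" "-A" a] by simp
    then show ?thesis
      using \<open>a \<le> A\<close> by (intro abs_le_square_iff[THEN iffD1]) auto
  qed
  define b where "b = sqrt (A\<^sup>2 - a\<^sup>2)"
  have b2: "b\<^sup>2 = A\<^sup>2 - a\<^sup>2"
    using \<open>a\<^sup>2 \<le> A\<^sup>2\<close> by (simp add: b_def)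
  have dist2: "dist u v = sqrt ((u$1 - v$1)\<^sup>2 + (u$2 - v$2)\<^sup>2)" for u v :: "real^2"
    by (simp add: dist_vec_def L2_set_def sum_2 dist_real_def)
  let ?p = "vector [0, 0] :: real^2" and ?q = "vector [l, 0] :: real^2"
    and ?r = "vector [a, b] :: real^2" and ?x = "vector [t, 0] :: real^2"
  have pq': "dist ?p ?q = d p q"
    unfolding dist2 pq using l by simp
  have pr': "dist ?p ?r = d p x"
    unfolding dist2 using AB(1) by (simp add: b2 A_def)
  have "(l - a)\<^sup>2 + b\<^sup>2 = B\<^sup>2"
    using a2 unfolding b2 by (simp add: power2_eq_square algebra_simps)
  then have qr': "dist ?q ?r = d q x"
    unfolding dist2 using AB(2) by (simp add: B_def)
  have "?x = (1 - t / l) *\<^sub>R ?p + (t / l) *\<^sub>R ?q"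
    using l by (simp add: vec_eq_iff forall_2)
  then have x': "?x \<in> closed_segment ?p ?q"
    unfolding closed_segment_def using t l by (intro CollectI exI[of _ "t / l"]) auto
  have px': "dist ?p ?x = d p (\<gamma> t)"
    unfolding dist2 p_def using geodesic_dist[OF \<gamma>, of 0 t] t by simp
  have tS: "\<gamma> t \<in> \<gamma> ` {0..l}" using t by simp
  have "d (\<gamma> t) x \<le> dist ?x ?r"
    by (rule CAT0[unfolded CAT0_def, THEN conjunct2, THEN conjunct2, rule_format,
          of p q x "\<gamma> ` {0..l}" T U ?p ?q ?r "\<gamma> t" x ?x ?r])
      (intro conjI M x S T U pq' pr' qr' tS x' px' ends_in_segment)+
  then have "(d x (\<gamma> t))\<^sup>2 \<le> (dist ?x ?r)\<^sup>2"
    by (simp add: commute)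
  also have "\<dots> = (t - a)\<^sup>2 + b\<^sup>2"
    unfolding dist2 by simp
  also have "\<dots> = t\<^sup>2 - 2 * t * a + A\<^sup>2"
    unfolding b2 by (simp add: power2_eq_square algebra_simps)
  finally have "l * (d x (\<gamma> t))\<^sup>2 \<le> l * (t\<^sup>2 - 2 * t * a + A\<^sup>2)"
    using l by simp
  also have "\<dots> = l * t\<^sup>2 - t * (2 * l * a) + l * A\<^sup>2"
    by (simp add: algebra_simps)
  also have "\<dots> = (l - t) * A\<^sup>2 + t * B\<^sup>2 - t * (l - t) * l"
    unfolding a2 by (simp add: power2_eq_square algebra_simps)
  finally have "l * (d x (\<gamma> t))\<^sup>2 \<le> (l - t) * A\<^sup>2 + t * B\<^sup>2 - t * (l - t) * l" .
  moreover have "A = d x (\<gamma> 0)" "B = d x (\<gamma> l)"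
    unfolding A_def B_def p_def q_def by (rule commute)+
  ultimately show ?thesis by (simp only:)
qed

text \<open>
  The same inequality between two points of an arbitrary geodesic, in either order: the function
  \<open>s \<mapsto> d(x, \<alpha> s)\<^sup>2\<close> is at least as convex as \<open>s\<^sup>2\<close>.
\<close>

lemma geodesic_convexity:
  assumes \<alpha>: "geodesic M d I \<alpha>" and ab: "a \<in> I" "b \<in> I" and x: "x \<in> M"
    and u: "0 \<le> u" "u \<le> 1"
  shows "(d x (\<alpha> (a + u * (b - a))))\<^sup>2
    \<le> (1 - u) * (d x (\<alpha> a))\<^sup>2 + u * (d x (\<alpha> b))\<^sup>2 - u * (1 - u) * (b - a)\<^sup>2"
proof -
  have *: "(d x (\<alpha> (a + u * (b - a))))\<^sup>2
    \<le> (1 - u) * (d x (\<alpha> a))\<^sup>2 + u * (d x (\<alpha> b))\<^sup>2 - u * (1 - u) * (b - a)\<^sup>2"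
    if "a < b" "a \<in> I" "b \<in> I" "0 \<le> u" "u \<le> 1" for a b u
  proof -
    have "{a..b} \<subseteq> I"
      using geodesic_between[OF \<alpha> that(2,3)] by (meson atLeastAtMost_iff subsetI)
    then have g: "geodesic M d {0..b - a} (\<lambda>s. \<alpha> (a + s))"
      by (intro geodesic_shift geodesic_restrict[OF \<alpha>]) (auto simp: is_interval_cc)
    have "(b - a) * (d x (\<alpha> (a + u * (b - a))))\<^sup>2
      \<le> (b - a - u * (b - a)) * (d x (\<alpha> a))\<^sup>2 + u * (b - a) * (d x (\<alpha> b))\<^sup>2
        - u * (b - a) * (b - a - u * (b - a)) * (b - a)"
      using comparison_inequality[OF g _ x, of "u * (b - a)"] that
      by (simp add: mult_left_le_one_le)
    also have "\<dots> = (b - a) * ((1 - u) * (d x (\<alpha> a))\<^sup>2 + u * (d x (\<alpha> b))\<^sup>2 - u * (1 - u) * (b - a)\<^sup>2)"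
      by (simp add: power2_eq_square algebra_simps)
    finally show ?thesis
      using \<open>a < b\<close> by simp
  qed
  consider "a < b" | "a = b" | "b < a" by linarith
  then show ?thesis
  proof cases
    case 1
    then show ?thesis using *[of a b u] assms by simp
  next
    case 2
    then show ?thesis by (simp add: algebra_simps)
  next
    case 3
    have eq: "b + (1 - u) * (a - b) = a + u * (b - a)" "(a - b)\<^sup>2 = (b - a)\<^sup>2"
      by (auto simp: algebra_simps power2_commute)
    show ?thesis
      using *[of b a "1 - u"] assms 3 unfolding eq by (simp add: algebra_simps)
  qed
qed

section \<open>Closest-point projection to a geodesic\<close>

text \<open>
  Closedness of the parameter interval makes the image complete, so that nearest points exist on it
  although the space itself need not be complete.
\<close>

definition complete_geodesic :: "real set \<Rightarrow> (real \<Rightarrow> 'a) \<Rightarrow> bool" where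
  "complete_geodesic I \<alpha> \<longleftrightarrow> closed I \<and> I \<noteq> {} \<and> geodesic M d I \<alpha>"

lemma complete_geodesic_Icc:
  "geodesic M d {0..l} \<alpha> \<Longrightarrow> 0 \<le> l \<Longrightarrow> complete_geodesic {0..l} \<alpha>"
  by (simp add: complete_geodesic_def)

lemma nearest_exists:
  assumes "complete_geodesic I \<alpha>" "x \<in> M"
  shows "\<exists>p. nearest d (\<alpha> ` I) x p"
proof -
  have I: "closed I" "I \<noteq> {}" and \<alpha>: "geodesic M d I \<alpha>"
    using assms by (auto simp: complete_geodesic_def)
  obtain s0 where s0: "s0 \<in> I" using I by blast
  let ?f = "\<lambda>s. d x (\<alpha> s)"
  have lip: "\<bar>?f s - ?f t\<bar> \<le> \<bar>s - t\<bar>" if "s \<in> I" "t \<in> I" for s t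
    using mdist_reverse_triangle[of "\<alpha> s" x "\<alpha> t"] geodesic_dist[OF \<alpha> that] 
      geodesic_in[OF \<alpha>] that assms(2) by (simp add: commute)
  have cont: "continuous_on I ?f"
    unfolding continuous_on_iff dist_real_def
    by (meson lip order_le_less_trans)
  \<comment> \<open>Outside this ball the distance to \<open>x\<close> exceeds its value at \<open>s0\<close>.\<close>
  let ?K = "I \<inter> cball s0 (2 * ?f s0)"
  have "compact ?K" "?K \<noteq> {}"
    using I s0 by (auto intro: closed_Int_compact)
  then obtain s1 where s1: "s1 \<in> ?K" "\<forall>s\<in>?K. ?f s1 \<le> ?f s"
    using continuous_attains_inf[of ?K ?f] continuous_on_subset[OF cont] by blast
  have "?f s1 \<le> ?f s" if "s \<in> I" for s
  proof (cases "s \<in> ?K")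
    case False
    then have "2 * ?f s0 < \<bar>s0 - s\<bar>" using that by (simp add: dist_real_def)
    also have "\<dots> \<le> ?f s0 + ?f s"
      using triangle[of "\<alpha> s0" x "\<alpha> s"] geodesic_dist[OF \<alpha> s0 that] geodesic_in[OF \<alpha>] s0 that assms(2)
      by (simp add: commute)
    finally have "?f s0 < ?f s" by simp
    moreover have "?f s1 \<le> ?f s0" using s1 s0 by simp
    ultimately show ?thesis by simp
  qed (use s1 in blast)
  then show ?thesis
    using s1 unfolding nearest_def by blast
qed

text \<open>
  The angle at a nearest point is at least a right angle: by strong convexity a violation would make a
  short step from \<open>p\<close> towards \<open>q\<close> reduce the distance to \<open>x\<close>.
\<close>

lemma nearest_Pythagoras:
  assumes \<alpha>: "geodesic M d I \<alpha>" and x: "x \<in> M" and p: "nearest d (\<alpha> ` I) x p" and q: "q \<in> \<alpha> ` I"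
  shows "(d x p)\<^sup>2 + (d p q)\<^sup>2 \<le> (d x q)\<^sup>2"
proof (rule ccontr)
  obtain a b where ab: "a \<in> I" "p = \<alpha> a" "b \<in> I" "q = \<alpha> b"
    using p q by (auto simp: nearest_def)
  define e D where "e = (d x p)\<^sup>2 + (d p q)\<^sup>2 - (d x q)\<^sup>2" and "D = (d p q)\<^sup>2"
  assume "\<not> ?thesis"
  then have e: "0 < e" unfolding e_def by linarith
  have pq: "D = (b - a)\<^sup>2"
    using geodesic_dist[OF \<alpha>, of a b] ab by (simp add: D_def power2_commute)
  have "d x p \<le> d x q"
    using p q unfolding nearest_def by blast
  then have "(d x p)\<^sup>2 \<le> (d x q)\<^sup>2"
    by (rule power_mono) simp
  then have le: "e \<le> D" unfolding e_def D_def by linarith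
  \<comment> \<open>A short step from \<open>p\<close> towards \<open>q\<close> decreases the distance to \<open>x\<close>; this parameter makes the
    quadratic error half of the linear gain.\<close>
  define u where "u = e / (2 * D)"
  have u: "0 < u" "u \<le> 1" using e le by (auto simp: u_def divide_simps)
  have "a + u * (b - a) \<in> I"
  proof (cases "a \<le> b")
    case True
    then have "u * (b - a) \<le> 1 * (b - a)" using u by (intro mult_right_mono) auto
    then show ?thesis
      using geodesic_between[OF \<alpha>, of a b "a + u * (b - a)"] ab u True by simp
  next
    case False
    then have "u * (a - b) \<le> 1 * (a - b)" using u by (intro mult_right_mono) auto
    moreover have "0 \<le> u * (a - b)" using u False by simp
    moreover have "a + u * (b - a) = a - u * (a - b)" by (simp add: algebra_simps)
    ultimately show ?thesis
      using geodesic_between[OF \<alpha>, of b a "a + u * (b - a)"] ab by simp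
  qed
  then have "d x p \<le> d x (\<alpha> (a + u * (b - a)))"
    using p by (auto simp: nearest_def)
  then have "(d x p)\<^sup>2 \<le> (d x (\<alpha> (a + u * (b - a))))\<^sup>2"
    by simp
  also have "\<dots> \<le> (1 - u) * (d x p)\<^sup>2 + u * (d x q)\<^sup>2 - u * (1 - u) * D"
    using geodesic_convexity[OF \<alpha> ab(1,3) x, of u] u ab pq by simp
  finally have "u * e \<le> u * (u * D)"
    by (simp add: e_def D_def algebra_simps)
  then have "e \<le> u * D" using u by simp
  also have "\<dots> = e / 2" using e le by (simp add: u_def)
  finally show False using e by simp
qed

lemma nearest_unique:
  assumes \<alpha>: "geodesic M d I \<alpha>" and x: "x \<in> M"
    and p: "nearest d (\<alpha> ` I) x p" and q: "nearest d (\<alpha> ` I) x q"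
  shows "p = q"
proof -
  have "p \<in> M" "q \<in> M" using p q geodesic_in[OF \<alpha>] by (auto simp: nearest_def)
  have "d x q \<le> d x p" using p q unfolding nearest_def by blast
  then have "(d x q)\<^sup>2 \<le> (d x p)\<^sup>2" by (rule power_mono) simp
  moreover have "q \<in> \<alpha> ` I" using q unfolding nearest_def by blast
  ultimately have "(d p q)\<^sup>2 \<le> 0"
    using nearest_Pythagoras[OF \<alpha> x p, of q] by linarith
  then show ?thesis using \<open>p \<in> M\<close> \<open>q \<in> M\<close> by simp
qed

lemma nearest_proj_onto:
  assumes "complete_geodesic I \<alpha>" "x \<in> M"
  shows "nearest d (\<alpha> ` I) x (proj_onto d (\<alpha> ` I) x)"
  using nearest_exists[OF assms] unfolding proj_onto_def nearest_def by (rule someI_ex)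

text \<open>
  The convexity inequality at the midpoint \<open>m\<close> of one diagonal bounds the distances from \<open>m\<close> to the other
  two points, hence the other diagonal.
\<close>

lemma four_point_inequality:
  assumes "a \<in> M" "b \<in> M" "p \<in> M" "q \<in> M"
  shows "(d a q)\<^sup>2 + (d b p)\<^sup>2 \<le> (d a p)\<^sup>2 + (d b q)\<^sup>2 + (d a b)\<^sup>2 + (d p q)\<^sup>2"
proof -
  obtain \<gamma> where \<gamma>: "geodesic M d {0..d a q} \<gamma>" "\<gamma> 0 = a" "\<gamma> (d a q) = q"
    using geodesic_exists[OF assms(1,4)] by blast
  \<comment> \<open>The midpoint of the diagonal, in the form in which the convexity inequality produces it.\<close>
  define m where "m = \<gamma> (0 + 1/2 * (d a q - 0))"
  have m: "m \<in> M" using geodesic_in[OF \<gamma>(1)] by (auto simp: m_def)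
  have *: "(d x m)\<^sup>2 \<le> 1/2 * (d x a)\<^sup>2 + 1/2 * (d x q)\<^sup>2 - 1/4 * (d a q)\<^sup>2" if "x \<in> M" for x
    using geodesic_convexity[OF \<gamma>(1), of 0 "d a q" x "1/2"] that
    unfolding \<gamma>(2,3) m_def[symmetric] by simp
  have "d b p \<le> d b m + d p m"
    using triangle[of b m p] assms m by (simp add: commute)
  then have "(d b p)\<^sup>2 \<le> (d b m + d p m)\<^sup>2"
    by (rule power_mono) simp
  also have "\<dots> \<le> 2 * (d b m)\<^sup>2 + 2 * (d p m)\<^sup>2"
    using sum_squares_bound[of "d b m" "d p m"] unfolding power2_sum by linarith
  finally show ?thesis
    using *[OF assms(2), unfolded commute[of b a]] *[OF assms(3), unfolded commute[of p a]]
    by linarith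
qed

text \<open>
  Adding the two Pythagorean inequalities for \<open>x\<close> and \<open>y\<close> and comparing with the four point inequality
  leaves \<open>2 d(p,q)\<^sup>2 \<le> d(x,y)\<^sup>2 + d(p,q)\<^sup>2\<close>.
\<close>

lemma nearest_nonexpansive:
  assumes \<alpha>: "geodesic M d I \<alpha>" and xy: "x \<in> M" "y \<in> M"
    and p: "nearest d (\<alpha> ` I) x p" and q: "nearest d (\<alpha> ` I) y q"
  shows "d p q \<le> d x y"
proof -
  have "p \<in> \<alpha> ` I" "q \<in> \<alpha> ` I" using p q by (auto simp: nearest_def)
  then have M: "p \<in> M" "q \<in> M" using geodesic_in[OF \<alpha>] by auto
  have "(d p q)\<^sup>2 \<le> (d x y)\<^sup>2"
    using nearest_Pythagoras[OF \<alpha> xy(1) p \<open>q \<in> \<alpha> ` I\<close>] nearest_Pythagoras[OF \<alpha> xy(2) q \<open>p \<in> \<alpha> ` I\<close>]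
      four_point_inequality[OF xy M]
    unfolding commute[of q p] by linarith
  then show ?thesis by (rule power2_le_imp_le) simp
qed

text \<open>
  The closest-point projection in the coordinate of the geodesic. With it curtains and halfspaces become
  preimages of intervals under a real function.
\<close>

definition foot :: "real set \<Rightarrow> (real \<Rightarrow> 'a) \<Rightarrow> 'a \<Rightarrow> real" where
  "foot I \<alpha> x = inv_into I \<alpha> (proj_onto d (\<alpha> ` I) x)"

lemma geodesic_inj:
  assumes "geodesic M d I \<alpha>"
  shows "inj_on \<alpha> I"
proof (rule inj_onI)
  fix s t assume st: "s \<in> I" "t \<in> I" and eq: "\<alpha> s = \<alpha> t"
  have "d (\<alpha> s) (\<alpha> t) = 0"
    unfolding eq by (rule mdist_zero[OF geodesic_in[OF assms st(2)]])
  then show "s = t"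
    using geodesic_dist[OF assms st] by simp
qed

lemma foot:
  assumes "complete_geodesic I \<alpha>" "x \<in> M"
  shows foot_in: "foot I \<alpha> x \<in> I"
    and foot_proj: "\<alpha> (foot I \<alpha> x) = proj_onto d (\<alpha> ` I) x"
    and foot_nearest: "nearest d (\<alpha> ` I) x (\<alpha> (foot I \<alpha> x))"
proof -
  have *: "proj_onto d (\<alpha> ` I) x \<in> \<alpha> ` I"
    using nearest_proj_onto[OF assms] by (simp add: nearest_def)
  show "foot I \<alpha> x \<in> I" unfolding foot_def by (rule inv_into_into[OF *])
  show eq: "\<alpha> (foot I \<alpha> x) = proj_onto d (\<alpha> ` I) x"
    unfolding foot_def by (rule f_inv_into_f[OF *])
  show "nearest d (\<alpha> ` I) x (\<alpha> (foot I \<alpha> x))"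
    unfolding eq by (rule nearest_proj_onto[OF assms])
qed

lemma foot_eqI:
  assumes "complete_geodesic I \<alpha>" "x \<in> M" "s \<in> I" "nearest d (\<alpha> ` I) x (\<alpha> s)"
  shows "foot I \<alpha> x = s"
proof -
  have \<alpha>: "geodesic M d I \<alpha>" using assms by (simp add: complete_geodesic_def)
  have "\<alpha> (foot I \<alpha> x) = \<alpha> s"
    using nearest_unique[OF \<alpha> assms(2) foot_nearest[OF assms(1,2)] assms(4)] .
  then show ?thesis
    using inj_onD[OF geodesic_inj[OF \<alpha>]] foot_in[OF assms(1,2)] assms(3) by blast
qed

lemma foot_on_geodesic:
  assumes I: "complete_geodesic I \<alpha>" and s: "s \<in> I"
  shows "foot I \<alpha> (\<alpha> s) = s"
proof -
  have M: "\<alpha> s \<in> M"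
    using I s geodesic_in[of M d I \<alpha> s] by (simp add: complete_geodesic_def)
  then have "nearest d (\<alpha> ` I) (\<alpha> s) (\<alpha> s)"
    using s by (simp add: nearest_def)
  then show ?thesis by (rule foot_eqI[OF I M s])
qed

lemma foot_nonexpansive:
  assumes I: "complete_geodesic I \<alpha>" and xy: "x \<in> M" "y \<in> M"
  shows "\<bar>foot I \<alpha> x - foot I \<alpha> y\<bar> \<le> d x y"
proof -
  have \<alpha>: "geodesic M d I \<alpha>" using I by (simp add: complete_geodesic_def)
  show ?thesis
    using nearest_nonexpansive[OF \<alpha> xy foot_nearest[OF I xy(1)] foot_nearest[OF I xy(2)]]
      geodesic_dist[OF \<alpha> foot_in[OF I xy(1)] foot_in[OF I xy(2)]] by simp
qed

lemma nearest_on_way: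
  assumes p: "nearest d S x p" and xp: "x \<in> M" "S \<subseteq> M" and z: "z \<in> M" "d x z + d z p = d x p"
  shows "nearest d S z p"
  unfolding nearest_def
proof (intro conjI ballI)
  show "p \<in> S" using p by (simp add: nearest_def)
  fix q assume q: "q \<in> S"
  then have "d x p \<le> d x q" using p by (simp add: nearest_def)
  also have "\<dots> \<le> d x z + d z q" using triangle xp z q by blast
  finally show "d z p \<le> d z q" using z by linarith
qed

lemma foot_on_way:
  assumes I: "complete_geodesic I \<alpha>" and x: "x \<in> M" and z: "z \<in> M"
    "d x z + d z (\<alpha> (foot I \<alpha> x)) = d x (\<alpha> (foot I \<alpha> x))"
  shows "foot I \<alpha> z = foot I \<alpha> x"
proof (rule foot_eqI[OF I z(1) foot_in[OF I x]])
  have "\<alpha> ` I \<subseteq> M" using I by (auto simp: complete_geodesic_def geodesic_def)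
  then show "nearest d (\<alpha> ` I) z (\<alpha> (foot I \<alpha> x))"
    using nearest_on_way[OF foot_nearest[OF I x] x] z by blast
qed

lemma proj_preimage_foot:
  assumes I: "complete_geodesic I \<alpha>" and J: "J \<subseteq> I"
  shows "proj_preimage M d I \<alpha> J = {x \<in> M. foot I \<alpha> x \<in> J}"
proof -
  have \<alpha>: "geodesic M d I \<alpha>" using I by (simp add: complete_geodesic_def)
  have "\<alpha> (foot I \<alpha> x) \<in> \<alpha> ` J \<longleftrightarrow> foot I \<alpha> x \<in> J" if "x \<in> M" for x
    using inj_on_image_mem_iff[OF geodesic_inj[OF \<alpha>] foot_in[OF I that] J] .
  then show ?thesis
    unfolding proj_preimage_def using foot_proj[OF I] by auto
qed


section \<open>Curtains and their sides\<close>

lemma connectedin_geodesic_image: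
  assumes \<alpha>: "geodesic M d I \<alpha>" and K: "K \<subseteq> I" "is_interval K"
  shows "connectedin mtopology (\<alpha> ` K)"
proof (rule connectedin_continuous_map_image)
  show "continuous_map (top_of_set I) mtopology \<alpha>"
    unfolding continuous_map_to_metric
  proof (intro ballI allI impI)
    fix s and e :: real assume "s \<in> topspace (top_of_set I)" and e: "0 < e"
    then have s: "s \<in> I" by simp
    have "\<alpha> t \<in> mball (\<alpha> s) e" if "t \<in> I \<inter> ball s e" for t
      using that s geodesic_dist[OF \<alpha> s, of t] geodesic_in[OF \<alpha> s] geodesic_in[OF \<alpha>, of t]
      by (simp add: dist_real_def)
    then show "\<exists>U. openin (top_of_set I) U \<and> s \<in> U \<and> (\<forall>t\<in>U. \<alpha> t \<in> mball (\<alpha> s) e)"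
      using s e by (intro exI[of _ "I \<inter> ball s e"]) (simp add: openin_open_Int)
  qed
  show "connectedin (top_of_set I) K"
    using K by (simp add: connectedin_subtopology is_interval_connected)
qed

lemma foot_on_segment:
  assumes I: "complete_geodesic I \<alpha>" and x: "x \<in> M"
    and \<gamma>: "geodesic M d {0..l} \<gamma>" "\<gamma> 0 = x" "\<gamma> l = \<alpha> (foot I \<alpha> x)" and s: "s \<in> {0..l}"
  shows "foot I \<alpha> (\<gamma> s) = foot I \<alpha> x"
proof (rule foot_on_way[OF I x geodesic_in[OF \<gamma>(1) s]])
  have "d (\<gamma> 0) (\<gamma> s) = s" "d (\<gamma> s) (\<gamma> l) = l - s" "d (\<gamma> 0) (\<gamma> l) = l"
    using geodesic_dist[OF \<gamma>(1), of 0 s] geodesic_dist[OF \<gamma>(1), of s l]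
      geodesic_dist[OF \<gamma>(1), of 0 l] s by auto
  then show "d x (\<gamma> s) + d (\<gamma> s) (\<alpha> (foot I \<alpha> x)) = d x (\<alpha> (foot I \<alpha> x))"
    unfolding \<gamma>(2,3) by simp
qed

text \<open>
  Every point of the preimage is joined inside it to the geodesic by the segment to its foot, along
  which the foot is constant.
\<close>

lemma connectedin_foot_preimage:
  assumes I: "complete_geodesic I \<alpha>" and J: "is_interval J"
  shows "connectedin mtopology {x \<in> M. foot I \<alpha> x \<in> J}" (is "connectedin _ ?S")
proof -
  have \<alpha>: "geodesic M d I \<alpha>" using I by (simp add: complete_geodesic_def)
  define K where "K = \<alpha> ` (I \<inter> J)"
  have K: "connectedin mtopology K"
    unfolding K_def using \<alpha> J
    by (intro connectedin_geodesic_image[OF \<alpha>] is_interval_Int) (auto simp: geodesic_def)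
  have KS: "K \<subseteq> ?S"
    unfolding K_def using foot_on_geodesic[OF I] geodesic_in[OF \<alpha>] by auto
  have ex: "\<exists>C. connectedin mtopology C \<and> x \<in> C \<and> K \<subseteq> C \<and> C \<subseteq> ?S" if "x \<in> ?S" for x
  proof -
    define p where "p = \<alpha> (foot I \<alpha> x)"
    have x: "x \<in> M" "foot I \<alpha> x \<in> J" using that by auto
    have p: "p \<in> M" "p \<in> K"
      using foot_in[OF I x(1)] geodesic_in[OF \<alpha>] x(2) by (auto simp: p_def K_def)
    obtain \<gamma> where \<gamma>: "geodesic M d {0..d x p} \<gamma>" "\<gamma> 0 = x" "\<gamma> (d x p) = p"
      using geodesic_exists[OF x(1) p(1)] by blast
    let ?C = "\<gamma> ` {0..d x p}"
    have in_C: "x \<in> ?C" "p \<in> ?C"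
      using \<gamma>(2,3) image_eqI[of x \<gamma> 0 "{0..d x p}"] image_eqI[of p \<gamma> "d x p" "{0..d x p}"] by auto
    have "connectedin mtopology ?C"
      by (rule connectedin_geodesic_image[OF \<gamma>(1)]) (auto simp: is_interval_cc)
    moreover have "?C \<subseteq> ?S"
    proof
      fix z assume "z \<in> ?C"
      then obtain s where s: "s \<in> {0..d x p}" "z = \<gamma> s" by blast
      have "foot I \<alpha> z = foot I \<alpha> x"
        unfolding s(2) by (rule foot_on_segment[OF I x(1) \<gamma>(1,2) _ s(1)]) (simp add: \<gamma> p_def[symmetric])
      then show "z \<in> ?S" using geodesic_in[OF \<gamma>(1) s(1)] s(2) x(2) by simp
    qed
    ultimately show ?thesis
      using connectedin_Un[OF K, of ?C] p(2) in_C KS by (intro exI[of _ "K \<union> ?C"]) blast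
  qed
  show ?thesis
  proof (cases "?S = {}")
    case True
    show ?thesis unfolding True by simp
  next
    case False
    then obtain x where "x \<in> ?S" by blast
    then have "K \<noteq> {}" using foot_in[OF I, of x] by (auto simp: K_def)
    define \<U> where "\<U> = {C. connectedin mtopology C \<and> K \<subseteq> C \<and> C \<subseteq> ?S}"
    have "\<Union>\<U> = ?S" using ex unfolding \<U>_def by blast
    moreover have "connectedin mtopology (\<Union>\<U>)"
    proof (rule connectedin_Union)
      show "\<Inter>\<U> \<noteq> {}" using \<open>K \<noteq> {}\<close> unfolding \<U>_def by blast
    qed (simp add: \<U>_def)
    ultimately show ?thesis by simp
  qed
qed

lemma continuous_map_nonexpansive:
  assumes "\<And>x y. x \<in> M \<Longrightarrow> y \<in> M \<Longrightarrow> \<bar>f x - f y\<bar> \<le> d x y"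
  shows "continuous_map mtopology euclideanreal f"
  unfolding continuous_map_from_metric
proof (intro conjI ballI allI impI)
  fix a U assume a: "a \<in> M" and U: "openin euclideanreal U \<and> f a \<in> U"
  then obtain e where e: "0 < e" "ball (f a) e \<subseteq> U"
    using open_contains_ball[of U] by auto
  have "f x \<in> U" if "x \<in> M \<and> d a x < e" for x
  proof -
    have "dist (f a) (f x) < e"
      using assms[OF a, of x] that by (simp add: dist_real_def)
    then show ?thesis using e(2) by auto
  qed
  then show "\<exists>r>0. \<forall>x. x \<in> M \<and> d a x < r \<longrightarrow> f x \<in> U" using e(1) by blast
qed simp

text \<open>
  The two halfspaces of \<open>h\<close> as an unordered pair. A curtain may be dual to several geodesics;
  \<open>sides\<close> allows any of them, and the pair turns out to be the same for all.
\<close>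

definition sides :: "'a set \<Rightarrow> 'a set \<Rightarrow> 'a set \<Rightarrow> bool" where
  "sides h N P \<longleftrightarrow> (\<exists>I \<alpha> r. dual_at M d h I \<alpha> r \<and>
     (N = halfspace_minus M d I \<alpha> r \<and> P = halfspace_plus M d I \<alpha> r \<or>
      N = halfspace_plus M d I \<alpha> r \<and> P = halfspace_minus M d I \<alpha> r))"

lemma sides_commute: "sides h N P \<Longrightarrow> sides h P N"
  unfolding sides_def by blast

lemma separates_iff: "separates M d h A B \<longleftrightarrow> (\<exists>N P. sides h N P \<and> A \<subseteq> N \<and> B \<subseteq> P)"
  unfolding separates_def sides_def by blast

lemma curtain_iff: "curtain M d h \<longleftrightarrow> (\<exists>N P. sides h N P)"
  unfolding curtain_def sides_def by blast

text \<open>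
  Coordinate-free form of a dual geodesic: a nonexpansive function with connected preimages of intervals
  that reads off the curtain and its sides. Unlike a geodesic with its position, it can be reversed by a
  change of sign, so statements about \<open>sides\<close> need only one orientation. The condition on the interior
  makes the curtain and both sides nonempty.
\<close>

definition height :: "'a set \<Rightarrow> 'a set \<Rightarrow> 'a set \<Rightarrow> real \<Rightarrow> ('a \<Rightarrow> real) \<Rightarrow> bool" where
  "height h N P r f \<longleftrightarrow>
     (\<forall>x\<in>M. \<forall>y\<in>M. \<bar>f x - f y\<bar> \<le> d x y) \<and>
     (\<forall>J. is_interval J \<longrightarrow> connectedin mtopology {x \<in> M. f x \<in> J}) \<and>
     {r - 1/2..r + 1/2} \<subseteq> interior (f ` M) \<and>
     h = {x \<in> M. f x \<in> {r - 1/2..r + 1/2}} \<and>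
     N = {x \<in> M. f x \<in> {..<r - 1/2}} \<and> P = {x \<in> M. f x \<in> {r + 1/2<..}}"

lemma dual_at_complete:
  assumes "dual_at M d h I \<alpha> r"
  shows "complete_geodesic I \<alpha>" "{r - 1/2..r + 1/2} \<subseteq> I" "{r - 1/2..r + 1/2} \<subseteq> interior I"
    "geodesic M d I \<alpha>"
proof -
  show i: "{r - 1/2..r + 1/2} \<subseteq> interior I" and g: "geodesic M d I \<alpha>" 
    using assms by (auto simp: dual_at_def)
  then show s: "{r - 1/2..r + 1/2} \<subseteq> I" using interior_subset by blast
  have "r \<in> I" using s by (auto simp: subset_iff)
  then show "complete_geodesic I \<alpha>"
    using assms by (auto simp: dual_at_def complete_geodesic_def)
qed

lemma dual_at_foot:
  assumes "dual_at M d h I \<alpha> r"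
  shows "h = {x \<in> M. foot I \<alpha> x \<in> {r - 1/2..r + 1/2}}"
    and "halfspace_minus M d I \<alpha> r = {x \<in> M. foot I \<alpha> x \<in> {..<r - 1/2}}"
    and "halfspace_plus M d I \<alpha> r = {x \<in> M. foot I \<alpha> x \<in> {r + 1/2<..}}"
proof -
  note I = dual_at_complete[OF assms]
  have "h = curtain_at M d I \<alpha> r" using assms by (simp add: dual_at_def)
  then show "h = {x \<in> M. foot I \<alpha> x \<in> {r - 1/2..r + 1/2}}"
    using proj_preimage_foot[OF I(1,2)] by (simp add: curtain_at_def)
  show "halfspace_minus M d I \<alpha> r = {x \<in> M. foot I \<alpha> x \<in> {..<r - 1/2}}"
    using proj_preimage_foot[OF I(1), of "I \<inter> {..<r - 1/2}"] foot_in[OF I(1)]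
    unfolding halfspace_minus_def by auto
  show "halfspace_plus M d I \<alpha> r = {x \<in> M. foot I \<alpha> x \<in> {r + 1/2<..}}"
    using proj_preimage_foot[OF I(1), of "I \<inter> {r + 1/2<..}"] foot_in[OF I(1)]
    unfolding halfspace_plus_def by auto
qed

lemma dual_at_height:
  assumes h: "dual_at M d h I \<alpha> r"
  shows "height h (halfspace_minus M d I \<alpha> r) (halfspace_plus M d I \<alpha> r) r (foot I \<alpha>)"
proof -
  note I = dual_at_complete[OF h]
  have "foot I \<alpha> ` M = I"
  proof
    show "foot I \<alpha> ` M \<subseteq> I" using foot_in[OF I(1)] by blast
    show "I \<subseteq> foot I \<alpha> ` M"
    proof
      fix s assume "s \<in> I"
      then show "s \<in> foot I \<alpha> ` M"
        using foot_on_geodesic[OF I(1), of s] geodesic_in[OF I(4), of s]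
          image_eqI[of s "foot I \<alpha>" "\<alpha> s" M] by simp
    qed
  qed
  then show ?thesis
    unfolding height_def
    using I(3) dual_at_foot[OF h] foot_nonexpansive[OF I(1)] connectedin_foot_preimage[OF I(1)]
    by simp
qed

lemma height_uminus:
  assumes "height h N P r f"
  shows "height h P N (- r) (\<lambda>x. - f x)"
proof -
  have img: "(\<lambda>x. - f x) ` M = uminus ` (f ` M)" by (simp add: image_image)
  have int: "interior (uminus ` (f ` M)) = uminus ` interior (f ` M)"
    by (simp add: interior_negations)
  have "{- r - 1/2..- r + 1/2} \<subseteq> interior ((\<lambda>x. - f x) ` M)"
    unfolding img int
  proof
    fix s assume "s \<in> {- r - 1/2..- r + 1/2}"
    then have "- s \<in> {r - 1/2..r + 1/2}" by auto
    then have "- s \<in> interior (f ` M)" using assms unfolding height_def by blast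
    then show "s \<in> uminus ` interior (f ` M)" by (intro image_eqI[of _ _ "- s"]) auto
  qed
  moreover have "connectedin mtopology {x \<in> M. - f x \<in> J}" if J: "is_interval J" for J
  proof -
    have "is_interval (uminus ` J)" using J by simp
    moreover have "{x \<in> M. - f x \<in> J} = {x \<in> M. f x \<in> uminus ` J}"
      by (auto simp: image_iff) (metis minus_minus)
    ultimately show ?thesis using assms unfolding height_def by simp
  qed
  moreover have "\<forall>x\<in>M. \<forall>y\<in>M. \<bar>- f x - - f y\<bar> \<le> d x y"
  proof (intro ballI)
    fix x y assume "x \<in> M" "y \<in> M"
    then have "\<bar>f x - f y\<bar> \<le> d x y" using assms unfolding height_def by blast
    then show "\<bar>- f x - - f y\<bar> \<le> d x y" by linarith
  qed
  moreover have "h = {x \<in> M. - f x \<in> {- r - 1/2..- r + 1/2}}"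
    "P = {x \<in> M. - f x \<in> {..<- r - 1/2}}" "N = {x \<in> M. - f x \<in> {- r + 1/2<..}}"
    using assms unfolding height_def by auto
  ultimately show ?thesis unfolding height_def by blast
qed

lemma sides_height:
  assumes "sides h N P"
  obtains f r where "height h N P r f"
  using assms dual_at_height height_uminus unfolding sides_def by metis

lemma sides_facts:
  assumes "sides h N P"
  shows sides_partition: "h \<union> N \<union> P = M" "h \<inter> N = {}" "h \<inter> P = {}" "N \<inter> P = {}"
    and sides_connected: "connectedin mtopology h" "connectedin mtopology N"
      "connectedin mtopology P" "connectedin mtopology (h \<union> N)" "connectedin mtopology (h \<union> P)"
    and sides_nonempty: "h \<noteq> {}" "N \<noteq> {}" "P \<noteq> {}"
proof -
  obtain f r where f: "height h N P r f" using sides_height[OF assms] .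
  have h: "h = {x \<in> M. f x \<in> {r - 1/2..r + 1/2}}" and N: "N = {x \<in> M. f x \<in> {..<r - 1/2}}"
    and P: "P = {x \<in> M. f x \<in> {r + 1/2<..}}"
    using f unfolding height_def by blast+
  have conn: "connectedin mtopology {x \<in> M. f x \<in> J}" if "is_interval J" for J
    using f that unfolding height_def by blast
  show "h \<union> N \<union> P = M" "h \<inter> N = {}" "h \<inter> P = {}" "N \<inter> P = {}"
    unfolding h N P by auto
  show "connectedin mtopology h" "connectedin mtopology N" "connectedin mtopology P"
    unfolding h N P by (intro conn; simp add: is_interval_1)+
  have un: "h \<union> N = {x \<in> M. f x \<in> {..r + 1/2}}" "h \<union> P = {x \<in> M. f x \<in> {r - 1/2..}}"
    unfolding h N P by auto
  show "connectedin mtopology (h \<union> N)" "connectedin mtopology (h \<union> P)"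
    unfolding un by (intro conn; simp add: is_interval_1)+
  have int: "r - 1/2 \<in> interior (f ` M)" "r + 1/2 \<in> interior (f ` M)" "r \<in> interior (f ` M)"
    using f unfolding height_def by auto
  then obtain e e' where e: "0 < e" "ball (r - 1/2) e \<subseteq> f ` M" "0 < e'" "ball (r + 1/2) e' \<subseteq> f ` M"
    unfolding mem_interior by blast
  have "r - 1/2 - e/2 \<in> ball (r - 1/2) e" "r + 1/2 + e'/2 \<in> ball (r + 1/2) e'"
    using e by (auto simp: dist_real_def)
  then obtain x y where "x \<in> M" "f x = r - 1/2 - e/2" "y \<in> M" "f y = r + 1/2 + e'/2"
    using e by (smt (verit) imageE subsetD)
  then show "N \<noteq> {}" "P \<noteq> {}" unfolding N P using e by auto
  obtain z where "z \<in> M" "f z = r" using int(3) interior_subset by blast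
  then have "z \<in> h" unfolding h by simp
  then show "h \<noteq> {}" by blast
qed

text \<open>
  The image of a connected set under a height function is an interval, which must contain \<open>r\<close> if it has
  points on both sides.
\<close>

lemma connectedin_misses_curtain:
  assumes h: "sides h N P" and A: "connectedin mtopology A" "A \<inter> h = {}"
  shows "A \<subseteq> N \<or> A \<subseteq> P"
proof (rule ccontr)
  obtain f r where f: "height h N P r f" using sides_height[OF h] .
  have eqs: "h = {x \<in> M. f x \<in> {r - 1/2..r + 1/2}}" "N = {x \<in> M. f x \<in> {..<r - 1/2}}"
    "P = {x \<in> M. f x \<in> {r + 1/2<..}}"
    using f unfolding height_def by blast+
  assume "\<not> ?thesis"
  moreover have AM: "A \<subseteq> M" using connectedin_subset_topspace[OF A(1)] by simp
  ultimately obtain x y where xy: "x \<in> A" "y \<in> A" "x \<in> P" "y \<in> N"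
    using sides_partition(1)[OF h] A(2) by blast
  have "continuous_map mtopology euclideanreal f"
    using continuous_map_nonexpansive f unfolding height_def by blast
  then have "connected (f ` A)"
    using connectedin_continuous_map_image[OF _ A(1)] by force
  moreover have "f y \<le> r" "r \<le> f x" using xy unfolding eqs by auto
  ultimately have "r \<in> f ` A"
    using connected_contains_Icc[of "f ` A" "f y" "f x"] xy(1,2) by auto
  then show False using A(2) AM unfolding eqs by auto
qed

lemma connectedin_meets_curtain:
  assumes "sides h N P" "connectedin mtopology A" "x \<in> A" "x \<in> N" "y \<in> A" "y \<in> P"
  shows "A \<inter> h \<noteq> {}"
  using connectedin_misses_curtain[OF assms(1,2)] sides_partition(4)[OF assms(1)] assms(3-6) by blast

text \<open>
  The sides are the connected components of the complement of the curtain, so they are determined by it.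
\<close>

lemma sides_unique:
  assumes 1: "sides h N P" and 2: "sides h N' P'"
  shows "N' = N \<and> P' = P \<or> N' = P \<and> P' = N"
proof -
  have "N \<subseteq> N' \<or> N \<subseteq> P'" "P \<subseteq> N' \<or> P \<subseteq> P'"
    using connectedin_misses_curtain[OF 2] sides_connected(2,3)[OF 1] sides_partition(2,3)[OF 1]
    by blast+
  moreover have "N' \<subseteq> N \<or> N' \<subseteq> P" "P' \<subseteq> N \<or> P' \<subseteq> P"
    using connectedin_misses_curtain[OF 1] sides_connected(2,3)[OF 2] sides_partition(2,3)[OF 2]
    by blast+
  ultimately show ?thesis
    using sides_partition(4)[OF 1] sides_partition(4)[OF 2] sides_nonempty[OF 1] sides_nonempty[OF 2]
    by blast
qed

text \<open>
  Curtains are thick: crossing one takes at least unit length.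
\<close>

lemma geodesic_crosses_curtain:
  assumes h: "sides h N P" and \<gamma>: "geodesic M d {0..l} \<gamma>" "0 \<le> l" and ends: "\<gamma> 0 \<in> N" "\<gamma> l \<in> P"
  obtains a where "0 \<le> a" "a + 1 \<le> l" "\<And>s. a \<le> s \<Longrightarrow> s \<le> a + 1 \<Longrightarrow> \<gamma> s \<in> h"
proof -
  obtain f r where f: "height h N P r f" using sides_height[OF h] .
  have eqs: "h = {x \<in> M. f x \<in> {r - 1/2..r + 1/2}}" "N = {x \<in> M. f x \<in> {..<r - 1/2}}"
    "P = {x \<in> M. f x \<in> {r + 1/2<..}}"
    using f unfolding height_def by blast+
  define g where "g = (\<lambda>s. f (\<gamma> s))"
  have lip: "\<bar>g s - g t\<bar> \<le> \<bar>s - t\<bar>" if "s \<in> {0..l}" "t \<in> {0..l}" for s t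
  proof -
    have "\<bar>f (\<gamma> s) - f (\<gamma> t)\<bar> \<le> d (\<gamma> s) (\<gamma> t)"
      using f geodesic_in[OF \<gamma>(1) that(1)] geodesic_in[OF \<gamma>(1) that(2)] unfolding height_def by blast
    then show ?thesis unfolding g_def geodesic_dist[OF \<gamma>(1) that] .
  qed
  have cont: "continuous_on {0..l} g"
    unfolding continuous_on_iff dist_real_def by (meson lip order_le_less_trans)
  have g: "g 0 < r - 1/2" "r + 1/2 < g l" using ends unfolding g_def eqs by auto
  \<comment> \<open>After the last time at height \<open>r - 1/2\<close> the geodesic climbs with speed at most 1, so it needs
    unit time to reach \<open>r + 1/2\<close>.\<close>
  let ?Z = "{s \<in> {0..l}. g s = r - 1/2}"
  have "closed ?Z" by (rule continuous_closed_preimage_constant[OF cont]) simp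
  moreover have "bounded ?Z" by (rule bounded_subset[of "{0..l}"]) auto
  ultimately have "compact ?Z" by (simp add: compact_eq_bounded_closed)
  moreover have "?Z \<noteq> {}"
    using IVT'[of g 0 "r - 1/2" l] g \<gamma>(2) cont by auto
  ultimately obtain a where a: "a \<in> ?Z" and max: "\<forall>s\<in>?Z. s \<le> a"
    using compact_attains_sup[of ?Z] by blast
  have a1: "a + 1 \<le> l" using lip[of l a] a g \<gamma>(2) by auto
  have "\<gamma> s \<in> h" if s: "a \<le> s" "s \<le> a + 1" for s
  proof -
    have sl: "s \<in> {0..l}" using s a a1 by auto
    have "r - 1/2 \<le> g s"
    proof (rule ccontr)
      assume "\<not> ?thesis"
      then obtain u where "s \<le> u" "u \<le> l" "g u = r - 1/2"
        using IVT'[of g s "r - 1/2" l] g sl continuous_on_subset[OF cont, of "{s..l}"] by auto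
      then have "u \<in> ?Z" using sl by auto
      then have "u = s" using max s(1) \<open>s \<le> u\<close> by force
      then show False using \<open>\<not> r - 1/2 \<le> g s\<close> \<open>g u = r - 1/2\<close> by simp
    qed
    moreover have "g s \<le> r + 1/2" using lip[of s a] a s sl by auto
    ultimately show ?thesis using geodesic_in[OF \<gamma>(1) sl] unfolding eqs g_def by simp
  qed
  then show ?thesis using that a a1 by auto
qed

text \<open>
  A geodesic from \<open>x\<close> to \<open>y\<close> spends a unit interval of time in each curtain. Such an interval contains an
  integer, and disjoint curtains get different integers.
\<close>

lemma card_separating_le:
  assumes A: "finite A" and h: "\<And>i. i \<in> A \<Longrightarrow> \<exists>N P. sides (h i) N P \<and> x \<in> N \<and> y \<in> P"
    and disj: "disjoint_family_on h A" and xy: "x \<in> M" "y \<in> M"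
  shows "real (card A) \<le> d x y + 1"
proof -
  obtain \<gamma> where \<gamma>: "geodesic M d {0..d x y} \<gamma>" "\<gamma> 0 = x" "\<gamma> (d x y) = y"
    using geodesic_exists[OF xy] by blast
  have "\<exists>z::int. 0 \<le> z \<and> z \<le> \<lfloor>d x y\<rfloor> \<and> \<gamma> (of_int z) \<in> h i" if i: "i \<in> A" for i
  proof -
    obtain N P where s: "sides (h i) N P" "x \<in> N" "y \<in> P" using h[OF i] by blast
    obtain a where a: "0 \<le> a" "a + 1 \<le> d x y" "\<And>s. a \<le> s \<Longrightarrow> s \<le> a + 1 \<Longrightarrow> \<gamma> s \<in> h i"
      using geodesic_crosses_curtain[OF s(1) \<gamma>(1)] s(2,3) \<gamma>(2,3) by auto
    have c: "a \<le> of_int \<lceil>a\<rceil>" "of_int \<lceil>a\<rceil> \<le> a + 1" by linarith+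
    then have "\<gamma> (of_int \<lceil>a\<rceil>) \<in> h i" by (rule a(3))
    moreover have "\<lceil>a\<rceil> \<le> \<lfloor>d x y\<rfloor>"
      unfolding le_floor_iff using c(2) a(2) by linarith
    moreover have "0 \<le> \<lceil>a\<rceil>" using a(1) by linarith
    ultimately show ?thesis by blast
  qed
  then obtain z :: "_ \<Rightarrow> int" where z: "\<And>i. i \<in> A \<Longrightarrow> 0 \<le> z i \<and> z i \<le> \<lfloor>d x y\<rfloor> \<and> \<gamma> (of_int (z i)) \<in> h i"
    by metis
  have "inj_on z A"
  proof (rule inj_onI)
    fix i j assume ij: "i \<in> A" "j \<in> A" "z i = z j"
    then have "\<gamma> (of_int (z i)) \<in> h i \<inter> h j" using z[OF ij(1)] z[OF ij(2)] by simp
    then show "i = j" using disj ij(1,2) unfolding disjoint_family_on_def by blast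
  qed
  then have "card A = card (z ` A)" by (simp add: card_image)
  also have "\<dots> \<le> card {0..\<lfloor>d x y\<rfloor>}"
    using z by (intro card_mono) auto
  finally have "card A \<le> nat (\<lfloor>d x y\<rfloor> + 1)" by simp
  moreover have "0 \<le> \<lfloor>d x y\<rfloor>" by simp
  ultimately have "int (card A) \<le> \<lfloor>d x y\<rfloor> + 1" by linarith
  then show ?thesis by linarith
qed


section \<open>Chains as nested families\<close>

text \<open>
  Chains put into order: the sides \<open>N i\<close> increase and the sides \<open>P i\<close> decrease. That each
  curtain separates its two neighbours, as required of a chain, implies
  nesting of all pairs; this form is the one in which chains are used.
\<close>

definition nested_curtains :: "nat \<Rightarrow> (nat \<Rightarrow> 'a set) \<Rightarrow> (nat \<Rightarrow> 'a set) \<Rightarrow> (nat \<Rightarrow> 'a set) \<Rightarrow> bool" where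
  "nested_curtains n h N P \<longleftrightarrow>
     (\<forall>i<n. sides (h i) (N i) (P i)) \<and>
     (\<forall>i j. i < j \<and> j < n \<longrightarrow> h i \<union> N i \<subseteq> N j \<and> h j \<union> P j \<subseteq> P i)"

lemma nested_curtains_sides: "nested_curtains n h N P \<Longrightarrow> i < n \<Longrightarrow> sides (h i) (N i) (P i)"
  unfolding nested_curtains_def by blast

lemma nested_curtains_less:
  assumes "nested_curtains n h N P" "i < j" "j < n"
  shows "h i \<subseteq> N j" "N i \<subseteq> N j" "h j \<subseteq> P i" "P j \<subseteq> P i"
  using assms unfolding nested_curtains_def by blast+

lemma nested_curtains_disjoint:
  assumes "nested_curtains n h N P" "i < n" "j < n" "i \<noteq> j"
  shows "h i \<inter> h j = {}"
proof -
  have *: "h i \<inter> h j = {}" if "i < j" "j < n" for i j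
    using nested_curtains_less(1)[OF assms(1) that]
      sides_partition(2)[OF nested_curtains_sides[OF assms(1) that(2)]] by blast
  consider "i < j" | "j < i" using assms(4) by linarith
  then show ?thesis
  proof cases
    case 1
    then show ?thesis using assms(3) by (rule *)
  next
    case 2
    then show ?thesis using *[OF _ assms(2)] by blast
  qed
qed

lemma nested_curtains_reverse:
  assumes n: "nested_curtains n h N P"
  shows "nested_curtains n (\<lambda>i. h (n - 1 - i)) (\<lambda>i. P (n - 1 - i)) (\<lambda>i. N (n - 1 - i))"
  unfolding nested_curtains_def
proof (intro conjI allI impI)
  fix i assume "i < n"
  then have "n - 1 - i < n" by simp
  then show "sides (h (n - 1 - i)) (P (n - 1 - i)) (N (n - 1 - i))"
    by (rule sides_commute[OF nested_curtains_sides[OF n]])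
next
  fix i j assume ij: "i < j \<and> j < n"
  then have "n - 1 - j < n - 1 - i" "n - 1 - i < n" by auto
  note nested_curtains_less[OF n this]
  then show "h (n - 1 - i) \<union> P (n - 1 - i) \<subseteq> P (n - 1 - j)"
    "h (n - 1 - j) \<union> N (n - 1 - j) \<subseteq> N (n - 1 - i)"
    by blast+
qed

text \<open>
  The set \<open>k \<union> P'\<close> is connected and avoids \<open>h\<close>, so it stays on the side of \<open>h\<close> that contains \<open>k\<close>;
  the other inclusion is the mirror image.
\<close>

lemma nested_step:
  assumes h: "sides h N P" and k: "sides k N' P'" and "h \<subseteq> N'" "k \<subseteq> P"
  shows "h \<union> N \<subseteq> N'" "k \<union> P' \<subseteq> P"
proof -
  have "(k \<union> P') \<inter> h = {}"
    using assms(3) sides_partition(2,4)[OF k] by blast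
  then have "k \<union> P' \<subseteq> N \<or> k \<union> P' \<subseteq> P"
    by (rule connectedin_misses_curtain[OF h sides_connected(5)[OF k]])
  then show "k \<union> P' \<subseteq> P"
    using assms(4) sides_partition(4)[OF h] sides_nonempty(1)[OF k] by blast
  have "(h \<union> N) \<inter> k = {}"
    using assms(4) sides_partition(3,4)[OF h] by blast
  then have "h \<union> N \<subseteq> N' \<or> h \<union> N \<subseteq> P'"
    by (rule connectedin_misses_curtain[OF k sides_connected(4)[OF h]])
  then show "h \<union> N \<subseteq> N'"
    using assms(3) sides_partition(4)[OF k] sides_nonempty(1)[OF h] by blast
qed

lemma nested_curtainsI:
  assumes s: "\<And>i. i < n \<Longrightarrow> sides (h i) (N i) (P i)"
    and N: "\<And>i. Suc i < n \<Longrightarrow> h i \<subseteq> N (Suc i)" and P: "\<And>i. Suc i < n \<Longrightarrow> h (Suc i) \<subseteq> P i"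
  shows "nested_curtains n h N P"
proof -
  have step: "h i \<union> N i \<subseteq> N (Suc i)" "h (Suc i) \<union> P (Suc i) \<subseteq> P i" if "Suc i < n" for i
    using nested_step[OF s s N P, of i] that by auto
  have *: "h i \<union> N i \<subseteq> N j \<and> h j \<union> P j \<subseteq> P i" if "i < j" "j < n" for i j
    using that
  proof (induction j)
    case 0
    then show ?case by simp
  next
    case (Suc j)
    show ?case
    proof (cases "i = j")
      case True
      then show ?thesis using step[of j] Suc.prems by simp
    next
      case False
      then have "h i \<union> N i \<subseteq> N j \<and> h j \<union> P j \<subseteq> P i" using Suc by simp
      then show ?thesis using step[of j] Suc.prems by blast
    qed
  qed
  show ?thesis unfolding nested_curtains_def
    by (intro conjI allI impI) (simp add: s, use * in blast, use * in blast)
qed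

lemma card_nested_separating_le:
  assumes n: "nested_curtains n h N P" and A: "A \<subseteq> {..<n}"
    and xy: "\<And>i. i \<in> A \<Longrightarrow> x \<in> N i \<and> y \<in> P i" "x \<in> M" "y \<in> M"
  shows "real (card A) \<le> d x y + 1"
proof (rule card_separating_le[OF _ _ _ xy(2,3)])
  show "finite A" using A finite_subset by blast
  show "\<exists>N P. sides (h i) N P \<and> x \<in> N \<and> y \<in> P" if "i \<in> A" for i
    using nested_curtains_sides[OF n, of i] A xy(1)[OF that] that by blast
  show "disjoint_family_on h A"
    unfolding disjoint_family_on_def using nested_curtains_disjoint[OF n] A by blast
qed

lemma curtain_nonempty: "curtain M d h \<Longrightarrow> h \<noteq> {}"
  unfolding curtain_iff using sides_nonempty by blast

text \<open>
  The two end curtains of a chain are dropped because nothing is required to lie on their outer sides.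
\<close>

lemma curtain_chain_nested:
  assumes c: "curtain_chain M d c" and card: "infinite c \<or> n + 2 \<le> card c"
  obtains h N P where "nested_curtains n h N P" "h ` {..<n} \<subseteq> c"
proof -
  obtain J :: "int set" and k where J: "\<forall>i\<in>J. \<forall>j\<in>J. {i..j} \<subseteq> J" "c = k ` J"
    "\<forall>i\<in>J. curtain M d (k i)" "disjoint_family_on k J"
    "\<forall>i. i - 1 \<in> J \<and> i \<in> J \<and> i + 1 \<in> J \<longrightarrow> separates M d (k i) (k (i - 1)) (k (i + 1))"
    using c unfolding curtain_chain_def by blast
  have "inj_on k J"
  proof (rule inj_onI)
    fix i j assume ij: "i \<in> J" "j \<in> J" "k i = k j"
    have "k i \<noteq> {}" using J(3) ij(1) curtain_nonempty by blast
    then show "i = j" using J(4) ij unfolding disjoint_family_on_def by blast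
  qed
  then have cardJ: "infinite J \<or> n + 2 \<le> card J"
    using card unfolding J(2) by (metis card_image finite_imageI)
  \<comment> \<open>The chain may be infinite in either direction, so a finite window is chosen first.\<close>
  have "\<exists>F. F \<subseteq> J \<and> finite F \<and> card F = n + 2"
    using cardJ infinite_arbitrarily_large[of J "n + 2"] obtain_subset_with_card_n[of "n + 2" J] by metis
  then obtain F where F: "F \<subseteq> J" "finite F" "card F = n + 2" by blast
  then have ne: "F \<noteq> {}" by auto
  define a where "a = Min F"
  have "F \<subseteq> {a..Max F}" using F(2) by (auto simp: a_def)
  then have "card F \<le> card {a..Max F}" by (intro card_mono) auto
  then have len: "a + int n + 1 \<le> Max F" using F(3) by simp
  have "{a..Max F} \<subseteq> J"
    using J(1) F(1) Min_in[OF F(2) ne] Max_in[OF F(2) ne] unfolding a_def by blast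
  then have inJ: "a + i \<in> J" if "0 \<le> i" "i \<le> int n + 1" for i
    using len that by auto
  have "\<exists>N P. sides (k (a + 1 + int i)) N P \<and> k (a + int i) \<subseteq> N \<and> k (a + 2 + int i) \<subseteq> P"
    if "i < n" for i
  proof -
    have "a + int i \<in> J" "a + 1 + int i \<in> J" "a + 2 + int i \<in> J"
      using inJ[of "int i"] inJ[of "1 + int i"] inJ[of "2 + int i"] that
      by (simp_all add: add.assoc)
    moreover have "a + 1 + int i - 1 = a + int i" "a + 1 + int i + 1 = a + 2 + int i"
      by simp_all
    ultimately have "separates M d (k (a + 1 + int i)) (k (a + int i)) (k (a + 2 + int i))"
      using J(5)[rule_format, of "a + 1 + int i"] by (simp only: simp_thms)
    then show ?thesis unfolding separates_iff by blast
  qed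
  then obtain N P where NP: "\<And>i. i < n \<Longrightarrow> sides (k (a + 1 + int i)) (N i) (P i)
      \<and> k (a + int i) \<subseteq> N i \<and> k (a + 2 + int i) \<subseteq> P i"
    by metis
  show ?thesis
  proof
    show "nested_curtains n (\<lambda>i. k (a + 1 + int i)) N P"
    proof (rule nested_curtainsI)
      fix i assume "Suc i < n"
      then show "k (a + 1 + int i) \<subseteq> N (Suc i)" "k (a + 1 + int (Suc i)) \<subseteq> P i"
        using NP[of i] NP[of "Suc i"] by (auto simp: algebra_simps)
    qed (use NP in blast)
    show "(\<lambda>i. k (a + 1 + int i)) ` {..<n} \<subseteq> c"
      unfolding J(2)
    proof (rule image_subsetI)
      fix i assume "i \<in> {..<n}"
      then show "k (a + 1 + int i) \<in> k ` J"
        using inJ[of "1 + int i"] by (simp add: algebra_simps)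
    qed
  qed
qed

text \<open>
  Each curtain of the family separates \<open>x\<close> from \<open>y\<close> in one of two directions; nesting propagates the
  direction of the first curtain to all others.
\<close>

lemma nested_curtains_orientation:
  assumes n: "nested_curtains n h N P"
    and sep: "\<And>i. i < n \<Longrightarrow> \<exists>N' P'. sides (h i) N' P' \<and> x \<in> N' \<and> y \<in> P'"
  shows "(\<forall>i<n. x \<in> N i \<and> y \<in> P i) \<or> (\<forall>i<n. x \<in> P i \<and> y \<in> N i)"
proof -
  have *: "x \<in> N i \<and> y \<in> P i \<or> x \<in> P i \<and> y \<in> N i" if i: "i < n" for i
  proof -
    obtain N' P' where s: "sides (h i) N' P'" "x \<in> N'" "y \<in> P'" using sep[OF i] by blast
    then show ?thesis using sides_unique[OF nested_curtains_sides[OF n i] s(1)] by blast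
  qed
  have up: "z \<in> N i" if "i < n" "z \<in> N 0" for i z
    using nested_curtains_less(2)[OF n, of 0 i] that by (cases "i = 0") auto
  have NP: "N i \<inter> P i = {}" if "i < n" for i
    by (rule sides_partition(4)[OF nested_curtains_sides[OF n that]])
  show ?thesis
  proof (cases "n = 0")
    case False
    then have "x \<in> N 0 \<or> y \<in> N 0" using *[of 0] by auto
    then show ?thesis using up[of _ x] up[of _ y] * NP by blast
  qed simp
qed

lemma L_chain_nested:
  assumes c: "L_chain M d L c" "chain_separates M d c {x} {y}" "n + 2 \<le> card c"
  obtains h N P where "nested_curtains n h N P" "\<And>i. i < n \<Longrightarrow> x \<in> N i \<and> y \<in> P i"
    "\<And>i j. i < n \<Longrightarrow> j < n \<Longrightarrow> i \<noteq> j \<Longrightarrow> L_separated M d L (h i) (h j)"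
proof -
  obtain h N P where n: "nested_curtains n h N P" and hc: "h ` {..<n} \<subseteq> c"
    using curtain_chain_nested[of c n] c unfolding L_chain_def by blast
  have L: "L_separated M d L (h i) (h j)" if ij: "i < n" "j < n" "i \<noteq> j" for i j
  proof -
    have "h i \<noteq> {}" by (rule sides_nonempty(1)[OF nested_curtains_sides[OF n ij(1)]])
    then have "h i \<noteq> h j" using nested_curtains_disjoint[OF n ij] by blast
    moreover have "h i \<in> c" "h j \<in> c" using hc ij by auto
    ultimately show ?thesis using c(1) unfolding L_chain_def pairwise_def by blast
  qed
  have "\<exists>N' P'. sides (h i) N' P' \<and> x \<in> N' \<and> y \<in> P'" if "i < n" for i
  proof -
    have "h i \<in> c" using hc that by auto
    then show ?thesis using c(2) unfolding chain_separates_def separates_iff by blast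
  qed
  then consider "\<forall>i<n. x \<in> N i \<and> y \<in> P i" | "\<forall>i<n. x \<in> P i \<and> y \<in> N i"
    using nested_curtains_orientation[OF n] by blast
  then show ?thesis
  proof cases
    case 1
    then show ?thesis using that[OF n] L by blast
  next
    case 2
    show ?thesis
    proof (rule that[OF nested_curtains_reverse[OF n]])
      show "x \<in> P (n - 1 - i) \<and> y \<in> N (n - 1 - i)" if "i < n" for i
        using 2 that by simp
      show "L_separated M d L (h (n - 1 - i)) (h (n - 1 - j))" if "i < n" "j < n" "i \<noteq> j" for i j
        by (rule L) (use that in auto)
    qed
  qed
qed


section \<open>The bottleneck property\<close>

lemma geodesic_meets_curtain:
  assumes h: "sides h N P" and \<beta>: "geodesic M d {a..b} \<beta>" "a \<le> b" and ends: "\<beta> a \<in> N" "\<beta> b \<in> P"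
  obtains s where "a \<le> s" "s \<le> b" "\<beta> s \<in> h"
proof -
  have "connectedin mtopology (\<beta> ` {a..b})"
    by (rule connectedin_geodesic_image[OF \<beta>(1)]) (auto simp: is_interval_cc)
  then have "\<beta> ` {a..b} \<inter> h \<noteq> {}"
    by (rule connectedin_meets_curtain[OF h _ _ ends(1) _ ends(2)]) (use \<beta>(2) in auto)
  then show ?thesis using that by auto
qed

lemma dual_curtain_chain:
  assumes dual: "\<And>i. i < n \<Longrightarrow> dual_at M d (h i) I \<alpha> (r i)"
    and gap: "\<And>i j. i < j \<Longrightarrow> j < n \<Longrightarrow> r i + 1 < r j"
  shows "curtain_chain M d (h ` {..<n})" "card (h ` {..<n}) = n"
proof -
  have minus: "h i \<subseteq> halfspace_minus M d I \<alpha> (r j)" and plus: "h j \<subseteq> halfspace_plus M d I \<alpha> (r i)"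
    if ij: "i < j" "j < n" for i j
  proof -
    have i: "i < n" using ij by simp
    show "h i \<subseteq> halfspace_minus M d I \<alpha> (r j)" "h j \<subseteq> halfspace_plus M d I \<alpha> (r i)"
      unfolding dual_at_foot(1)[OF dual[OF i]] dual_at_foot(1)[OF dual[OF ij(2)]]
        dual_at_foot(2)[OF dual[OF ij(2)]] dual_at_foot(3)[OF dual[OF i]]
      using gap[OF ij] by auto
  qed
  have s: "sides (h i) (halfspace_minus M d I \<alpha> (r i)) (halfspace_plus M d I \<alpha> (r i))" if "i < n" for i
    unfolding sides_def using dual[OF that] by blast
  have disj: "h i \<inter> h j = {}" if ij: "i < j" "j < n" for i j
    using minus[OF ij] sides_partition(2)[OF s[OF ij(2)]] by blast
  have disj': "h i \<inter> h j = {}" if "i < n" "j < n" "i \<noteq> j" for i j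
  proof -
    consider "i < j" | "j < i" using \<open>i \<noteq> j\<close> by linarith
    then show ?thesis using disj[of i j] disj[of j i] that(1,2) by cases blast+
  qed
  have "inj_on h {..<n}"
  proof (rule inj_onI)
    fix i j assume ij: "i \<in> {..<n}" "j \<in> {..<n}" "h i = h j"
    then have "h i \<noteq> {}" using sides_nonempty(1)[OF s[of i]] by simp
    then show "i = j" using disj'[of i j] ij by auto
  qed
  then show "card (h ` {..<n}) = n" by (simp add: card_image)
  show "curtain_chain M d (h ` {..<n})"
    unfolding curtain_chain_def
  proof (intro exI conjI)
    let ?J = "{0..<int n}" and ?k = "\<lambda>i. h (nat i)"
    show "\<forall>i\<in>?J. \<forall>k\<in>?J. {i..k} \<subseteq> ?J" by auto
    have "{..<n} = nat ` ?J"
    proof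
      show "{..<n} \<subseteq> nat ` ?J"
      proof
        fix i assume "i \<in> {..<n}"
        then show "i \<in> nat ` ?J" by (intro image_eqI[of _ _ "int i"]) auto
      qed
    qed auto
    then show "h ` {..<n} = ?k ` ?J" by (simp add: image_image)
    show "\<forall>i\<in>?J. curtain M d (?k i)"
    proof
      fix i assume "i \<in> ?J"
      then have "nat i < n" by auto
      then show "curtain M d (?k i)" unfolding curtain_def using dual by blast
    qed
    show "disjoint_family_on ?k ?J"
      unfolding disjoint_family_on_def
    proof (intro ballI impI)
      fix i j assume ij: "i \<in> ?J" "j \<in> ?J" "i \<noteq> j"
      show "?k i \<inter> ?k j = {}" by (rule disj') (use ij in auto)
    qed
    show "\<forall>i. i - 1 \<in> ?J \<and> i \<in> ?J \<and> i + 1 \<in> ?J \<longrightarrow> separates M d (?k i) (?k (i - 1)) (?k (i + 1))"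
    proof (intro allI impI)
      fix i assume "i - 1 \<in> ?J \<and> i \<in> ?J \<and> i + 1 \<in> ?J"
      then have i: "nat (i - 1) < nat i" "nat i < nat (i + 1)" "nat (i + 1) < n" by auto
      then have "nat i < n" by simp
      then show "separates M d (?k i) (?k (i - 1)) (?k (i + 1))"
        unfolding separates_iff using s minus[OF i(1)] plus[OF i(2,3)] by blast
    qed
  qed
qed

lemma L_separated_commute: "L_separated M d L h k \<Longrightarrow> L_separated M d L k h"
  unfolding L_separated_def by (simp add: Int_commute conj_commute)

text \<open>
  First variation: if the foot of \<open>w\<close> is not the initial point, then moving towards the foot strictly
  approaches \<open>w\<close>. This expresses, without angles, that the angle at \<open>\<gamma> 0\<close> is smaller than a right angle.
\<close>

lemma closer_towards_foot:
  assumes \<gamma>: "complete_geodesic {0..e} \<gamma>" and w: "w \<in> M" and u: "0 < u" "u \<le> foot {0..e} \<gamma> w"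
  shows "d w (\<gamma> u) < d w (\<gamma> 0)"
proof -
  define \<sigma> where "\<sigma> = foot {0..e} \<gamma> w"
  have g: "geodesic M d {0..e} \<gamma>" using \<gamma> by (simp add: complete_geodesic_def)
  have \<sigma>: "\<sigma> \<in> {0..e}" "0 < \<sigma>" using foot_in[OF \<gamma> w] u by (auto simp: \<sigma>_def)
  then have z: "0 \<in> {0..e}" by auto
  have dz: "d (\<gamma> \<sigma>) (\<gamma> 0) = \<sigma>" using geodesic_dist[OF g \<sigma>(1) z] \<sigma>(2) by simp
  have "(d w (\<gamma> \<sigma>))\<^sup>2 + (d (\<gamma> \<sigma>) (\<gamma> 0))\<^sup>2 \<le> (d w (\<gamma> 0))\<^sup>2"
    by (rule nearest_Pythagoras[OF g w]) (use foot_nearest[OF \<gamma> w] z in \<open>auto simp: \<sigma>_def\<close>)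
  then have 1: "(d w (\<gamma> \<sigma>))\<^sup>2 \<le> (d w (\<gamma> 0))\<^sup>2 - \<sigma>\<^sup>2" unfolding dz by linarith
  define v where "v = u / \<sigma>"
  have v: "0 < v" "v \<le> 1" "v * \<sigma> = u" using u \<sigma> by (auto simp: v_def \<sigma>_def[symmetric])
  have "(d w (\<gamma> u))\<^sup>2 \<le> (1 - v) * (d w (\<gamma> 0))\<^sup>2 + v * (d w (\<gamma> \<sigma>))\<^sup>2 - v * (1 - v) * \<sigma>\<^sup>2"
    using geodesic_convexity[OF g z \<sigma>(1) w, of v] v by simp
  also have "\<dots> \<le> (1 - v) * (d w (\<gamma> 0))\<^sup>2 + v * ((d w (\<gamma> 0))\<^sup>2 - \<sigma>\<^sup>2) - v * (1 - v) * \<sigma>\<^sup>2"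
    using mult_left_mono[OF 1, of v] v(1) by linarith
  also have "\<dots> = (d w (\<gamma> 0))\<^sup>2 - v * \<sigma>\<^sup>2 - v * (1 - v) * \<sigma>\<^sup>2"
    by (simp add: algebra_simps)
  also have "\<dots> < (d w (\<gamma> 0))\<^sup>2"
  proof -
    have "0 < v * \<sigma>\<^sup>2" "0 \<le> v * (1 - v) * \<sigma>\<^sup>2" using v \<sigma>(2) by simp_all
    then show ?thesis by linarith
  qed
  finally show ?thesis by (rule power_less_imp_less_base) simp
qed

text \<open>
  Let \<open>p\<close> be the point of \<open>\<beta>\<close> in \<open>h2\<close> and \<open>q\<close> its nearest point on \<open>\<alpha>\<close>, and consider curtains dual to
  \<open>[p,q]\<close>. All of \<open>\<alpha>\<close> lies beyond them. On the near side lie \<open>p\<close> itself and one of the points where \<open>\<beta>\<close> meets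
  \<open>h1\<close> or \<open>h3\<close>. Since \<open>\<alpha>\<close> meets all three curtains and curtains are connected, each curtain dual to \<open>[p,q]\<close> meets
  \<open>h2\<close> and the same one of \<open>h1\<close>, \<open>h3\<close>; by \<open>L\<close>-separation there are at most \<open>L\<close> such disjoint curtains, so \<open>[p,q]\<close> is
  short.
\<close>

lemma bottleneck:
  assumes s1: "sides h1 N1 P1" and s2: "sides h2 N2 P2" and s3: "sides h3 N3 P3"
    and nest: "h2 \<subseteq> P1" "h2 \<subseteq> N3"
    and L: "L_separated M d L h1 h2" "L_separated M d L h2 h3"
    and \<alpha>: "geodesic M d {0..l} \<alpha>" "0 \<le> l" "\<alpha> 0 \<in> N1 \<inter> N2 \<inter> N3" "\<alpha> l \<in> P1 \<inter> P2 \<inter> P3"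
    and \<beta>: "geodesic M d {0..m} \<beta>" "\<beta> 0 \<in> N1" "\<beta> m \<in> P3"
    and t: "t \<in> {0..m}" "\<beta> t \<in> h2"
  shows "\<exists>s\<in>{0..l}. d (\<beta> t) (\<alpha> s) \<le> 2 * real L + 4"
proof (rule ccontr)
  assume neg: "\<not> ?thesis"
  define p where "p = \<beta> t"
  have p: "p \<in> M" "p \<in> h2" using geodesic_in[OF \<beta>(1) t(1)] t(2) by (auto simp: p_def)
  have I: "complete_geodesic {0..l} \<alpha>" using complete_geodesic_Icc[OF \<alpha>(1,2)] .
  define s q where "s = foot {0..l} \<alpha> p" and "q = \<alpha> s"
  have s: "s \<in> {0..l}" unfolding s_def by (rule foot_in[OF I p(1)])
  have q: "q \<in> M" unfolding q_def by (rule geodesic_in[OF \<alpha>(1) s])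
  define e where "e = d p q"
  have "\<not> d (\<beta> t) (\<alpha> s) \<le> 2 * real L + 4" using neg s by blast
  then have e: "2 * real L + 4 < e" unfolding e_def q_def p_def by linarith
  obtain \<gamma> where \<gamma>: "geodesic M d {0..e} \<gamma>" "\<gamma> 0 = p" "\<gamma> e = q"
    using geodesic_exists[OF p(1) q] unfolding e_def by blast
  have J: "complete_geodesic {0..e} \<gamma>" using complete_geodesic_Icc[OF \<gamma>(1)] e by simp
  have ends: "0 \<in> {0..e}" "e \<in> {0..e}" using e by auto
  \<comment> \<open>Each point of the new segment has its foot on \<open>\<alpha>\<close> at \<open>q\<close>, so the Pythagorean inequality makes
    \<open>q\<close> the point of the segment closest to any point of \<open>\<alpha>\<close> (an angle of at least a right angle
    at \<open>q\<close>): all of \<open>\<alpha>\<close> lies beyond every curtain dual to the segment.\<close>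
  have far: "foot {0..e} \<gamma> (\<alpha> u) = e" if u: "u \<in> {0..l}" for u
  proof (rule foot_eqI[OF J geodesic_in[OF \<alpha>(1) u] ends(2)])
    show "nearest d (\<gamma> ` {0..e}) (\<alpha> u) (\<gamma> e)"
      unfolding nearest_def
    proof (intro conjI ballI)
      show "\<gamma> e \<in> \<gamma> ` {0..e}" using ends by blast
      fix w assume "w \<in> \<gamma> ` {0..e}"
      then obtain v where v: "v \<in> {0..e}" "w = \<gamma> v" by blast
      have w: "w \<in> M" unfolding v(2) by (rule geodesic_in[OF \<gamma>(1) v(1)])
      have "foot {0..l} \<alpha> w = s"
        unfolding v(2) s_def
        by (rule foot_on_segment[OF I p(1) \<gamma>(1,2) _ v(1)]) (simp add: \<gamma>(3) q_def s_def)
      then have "nearest d (\<alpha> ` {0..l}) w q" using foot_nearest[OF I w] by (simp add: q_def)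
      then have "(d w q)\<^sup>2 + (d q (\<alpha> u))\<^sup>2 \<le> (d w (\<alpha> u))\<^sup>2"
        by (rule nearest_Pythagoras[OF \<alpha>(1) w]) (use u in blast)
      then have "(d q (\<alpha> u))\<^sup>2 \<le> (d w (\<alpha> u))\<^sup>2"
        using zero_le_power2[of "d w q"] by linarith
      then have "d q (\<alpha> u) \<le> d w (\<alpha> u)" by (rule power2_le_imp_le) simp
      then show "d (\<alpha> u) (\<gamma> e) \<le> d (\<alpha> u) w"
        unfolding \<gamma>(3) commute[of "\<alpha> u"] .
    qed
  qed
  have near_p: "foot {0..e} \<gamma> p = 0" using foot_on_geodesic[OF J ends(1)] unfolding \<gamma>(2) .
  \<comment> \<open>A segment longer than \<open>2 L + 4\<close> has room for \<open>L + 1\<close> disjoint dual curtains, one too many for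
    \<open>L\<close>-separation.\<close>
  define k where "k i = curtain_at M d {0..e} \<gamma> (2 * real i + 1)" for i :: nat
  have dual: "dual_at M d (k i) {0..e} \<gamma> (2 * real i + 1)" if "i < Suc L" for i
  proof -
    have "real i \<le> real L" using that by simp
    then show ?thesis using \<gamma>(1) e unfolding dual_at_def k_def by auto
  qed
  have chain: "curtain_chain M d (k ` {..<Suc L})" "card (k ` {..<Suc L}) = Suc L"
  proof -
    have gap: "2 * real i + 1 + 1 < 2 * real j + 1" if "i < j" for i j :: nat
      using that by linarith
    show "curtain_chain M d (k ` {..<Suc L})" "card (k ` {..<Suc L}) = Suc L"
      using dual_curtain_chain(1,2)[of "Suc L" k "{0..e}" \<gamma> "\<lambda>i. 2 * real i + 1"] dual gap by blast+
  qed
  have meets: "k i \<inter> A \<noteq> {}"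
    if i: "i < Suc L" and A: "connectedin mtopology A" "z \<in> A" "foot {0..e} \<gamma> z = 0"
      "u \<in> {0..l}" "\<alpha> u \<in> A" for i A z u
  proof -
    have z: "z \<in> M" using connectedin_subset_topspace[OF A(1)] A(2) by auto
    have "sides (k i) (halfspace_minus M d {0..e} \<gamma> (2 * real i + 1))
        (halfspace_plus M d {0..e} \<gamma> (2 * real i + 1))"
      unfolding sides_def using dual[OF i] by blast
    moreover have "z \<in> halfspace_minus M d {0..e} \<gamma> (2 * real i + 1)"
      unfolding dual_at_foot(2)[OF dual[OF i]] using z A(3) by simp
    moreover have "\<alpha> u \<in> halfspace_plus M d {0..e} \<gamma> (2 * real i + 1)"
    proof -
      have "real i \<le> real L" using i by simp
      then show ?thesis
        unfolding dual_at_foot(3)[OF dual[OF i]] using far[OF A(4)] geodesic_in[OF \<alpha>(1) A(4)] e by simp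
    qed
    ultimately have "A \<inter> k i \<noteq> {}"
      using connectedin_meets_curtain[of "k i" _ _ A z "\<alpha> u"] A by blast
    then show ?thesis by blast
  qed
  have contra: False
    if h: "sides h N P" "L_separated M d L h2 h" and \<alpha>NP: "\<alpha> 0 \<in> N" "\<alpha> l \<in> P"
      and z: "z \<in> h" "foot {0..e} \<gamma> z = 0" for h N P z
  proof -
    obtain u where u: "u \<in> {0..l}" "\<alpha> u \<in> h"
      using geodesic_meets_curtain[OF h(1) \<alpha>(1,2) \<alpha>NP] by auto
    obtain u2 where u2: "u2 \<in> {0..l}" "\<alpha> u2 \<in> h2"
      using geodesic_meets_curtain[OF s2 \<alpha>(1,2)] \<alpha>(3,4) by auto
    have "\<forall>x\<in>k ` {..<Suc L}. x \<inter> h2 \<noteq> {} \<and> x \<inter> h \<noteq> {}"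
      using meets[OF _ sides_connected(1)[OF h(1)] z u] meets[OF _ sides_connected(1)[OF s2] p(2) near_p u2]
      by blast
    then have "card (k ` {..<Suc L}) \<le> L"
      using h(2) chain(1) unfolding L_separated_def by blast
    then show False using chain(2) by simp
  qed
  \<comment> \<open>The two directions of \<open>\<beta>\<close> at \<open>p\<close> cannot both make an angle smaller than a right angle with the
    segment, since otherwise a shortcut through the segment would beat \<open>\<beta>\<close>.\<close>
  have m: "0 \<le> t" "t \<le> m" using t by auto
  have "{0..t} \<subseteq> {0..m}" "{t..m} \<subseteq> {0..m}" using m by auto
  then have \<beta>': "geodesic M d {0..t} \<beta>" "geodesic M d {t..m} \<beta>"
    using geodesic_restrict[OF \<beta>(1)] is_interval_cc by blast+
  have pNP: "\<beta> t \<in> P1" "\<beta> t \<in> N3" using nest t(2) by auto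
  obtain v1 where v1: "0 \<le> v1" "v1 \<le> t" "\<beta> v1 \<in> h1"
    using geodesic_meets_curtain[OF s1 \<beta>'(1) m(1) \<beta>(2) pNP(1)] by blast
  obtain v3 where v3: "t \<le> v3" "v3 \<le> m" "\<beta> v3 \<in> h3"
    using geodesic_meets_curtain[OF s3 \<beta>'(2) m(2) pNP(2) \<beta>(3)] by blast
  have in_m: "v1 \<in> {0..m}" "v3 \<in> {0..m}" using v1 v3 m by auto
  define w1 w3 where "w1 = \<beta> v1" and "w3 = \<beta> v3"
  have w: "w1 \<in> M" "w3 \<in> M" unfolding w1_def w3_def using in_m by (auto intro: geodesic_in[OF \<beta>(1)])
  have "foot {0..e} \<gamma> w1 = 0 \<or> foot {0..e} \<gamma> w3 = 0"
  proof (rule ccontr)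
    assume "\<not> ?thesis"
    then have pos: "0 < foot {0..e} \<gamma> w1" "0 < foot {0..e} \<gamma> w3"
      using foot_in[OF J w(1)] foot_in[OF J w(2)] by auto
    define u where "u = min (foot {0..e} \<gamma> w1) (foot {0..e} \<gamma> w3)"
    have u: "0 < u" "u \<le> foot {0..e} \<gamma> w1" "u \<le> foot {0..e} \<gamma> w3" using pos by (auto simp: u_def)
    have "u \<in> {0..e}" using u foot_in[OF J w(1)] by auto
    then have uM: "\<gamma> u \<in> M" by (rule geodesic_in[OF \<gamma>(1)])
    have "d w1 w3 \<le> d w1 (\<gamma> u) + d (\<gamma> u) w3" by (rule triangle[OF w(1) uM w(2)])
    also have "\<dots> < d w1 p + d w3 p"
      using closer_towards_foot[OF J w(1) u(1,2)] closer_towards_foot[OF J w(2) u(1,3)]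
      unfolding \<gamma>(2) commute[of "\<gamma> u"] by linarith
    also have "\<dots> = d w1 w3"
      unfolding w1_def w3_def p_def geodesic_dist[OF \<beta>(1) in_m] geodesic_dist[OF \<beta>(1) in_m(1) t(1)]
        geodesic_dist[OF \<beta>(1) in_m(2) t(1)] using v1 v3 by linarith
    finally show False by simp
  qed
  then show False
  proof
    assume "foot {0..e} \<gamma> w1 = 0"
    then show False
      using contra[OF s1 L_separated_commute[OF L(1)], of w1] \<alpha>(3,4) v1(3) by (simp add: w1_def)
  next
    assume "foot {0..e} \<gamma> w3 = 0"
    then show False
      using contra[OF s3 L(2), of w3] \<alpha>(3,4) v3(3) by (simp add: w3_def)
  qed
qed


section \<open>The metrics of L-chains\<close>

lemma curtain_chain_empty: "curtain_chain M d {}"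
  unfolding curtain_chain_def by (intro exI[of _ "{}"]) (auto simp: disjoint_family_on_def)

lemma card_chain_separating_le:
  assumes c: "curtain_chain M d c" "chain_separates M d c {x} {y}" and xy: "x \<in> M" "y \<in> M"
  shows "real (card c) \<le> d x y + 1"
proof (cases "finite c")
  case True
  have disj: "disjoint_family_on (\<lambda>h. h) c"
  proof -
    obtain J :: "int set" and k where J: "c = k ` J" "disjoint_family_on k J"
      using c(1) unfolding curtain_chain_def by blast
    show ?thesis
      unfolding disjoint_family_on_def
    proof (intro ballI impI)
      fix a b assume "a \<in> c" "b \<in> c" "a \<noteq> b"
      then obtain i j where "i \<in> J" "j \<in> J" "a = k i" "b = k j" "i \<noteq> j"
        unfolding J(1) by blast
      then show "a \<inter> b = {}" using J(2) unfolding disjoint_family_on_def by blast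
    qed
  qed
  show ?thesis
  proof (rule card_separating_le[OF True _ disj xy])
    show "\<exists>N P. sides h N P \<and> x \<in> N \<and> y \<in> P" if "h \<in> c" for h
      using c(2) that unfolding chain_separates_def separates_iff by blast
  qed
next
  case False
  then show ?thesis by (simp add: add_nonneg_nonneg)
qed

text \<open>
  The cardinalities that compete in the definition are bounded in terms of \<open>d x y\<close> and include that of the
  empty chain, so the maximum is a genuine one.
\<close>

lemma dist_L_attained:
  assumes xy: "x \<in> M" "y \<in> M" "x \<noteq> y"
  shows "\<exists>c. L_chain M d L c \<and> chain_separates M d c {x} {y} \<and> dist_L M d L x y = 1 + real (card c)"
    and "L_chain M d L c \<Longrightarrow> chain_separates M d c {x} {y} \<Longrightarrow> 1 + real (card c) \<le> dist_L M d L x y"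
proof -
  define S where "S = {card c | c. L_chain M d L c \<and> chain_separates M d c {x} {y}}"
  have "s \<le> nat \<lfloor>d x y + 1\<rfloor>" if s: "s \<in> S" for s
  proof -
    obtain c where "s = card c" "curtain_chain M d c" "chain_separates M d c {x} {y}"
      using s unfolding S_def L_chain_def by blast
    then have "real s \<le> d x y + 1" using card_chain_separating_le xy(1,2) by simp
    then show ?thesis by (rule le_nat_floor)
  qed
  then have fin: "finite S" using finite_nat_set_iff_bounded_le by blast
  have "L_chain M d L {}" "chain_separates M d {} {x} {y}"
    unfolding L_chain_def chain_separates_def using curtain_chain_empty by auto
  then have ne: "S \<noteq> {}" unfolding S_def by blast
  have eq: "dist_L M d L x y = 1 + real (Max S)"
    using xy(3) by (simp add: dist_L_def S_def)
  show "\<exists>c. L_chain M d L c \<and> chain_separates M d c {x} {y} \<and> dist_L M d L x y = 1 + real (card c)"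
    using Max_in[OF fin ne] unfolding eq unfolding S_def by auto
  show "1 + real (card c) \<le> dist_L M d L x y"
    if "L_chain M d L c" "chain_separates M d c {x} {y}"
  proof -
    have "card c \<in> S" using that unfolding S_def by blast
    then show ?thesis unfolding eq using Max_ge[OF fin] by simp
  qed
qed

lemma dist_L_self: "dist_L M d L x x = 0"
  by (simp add: dist_L_def)

lemma dist_L_bounds:
  assumes "x \<in> M" "y \<in> M"
  shows "0 \<le> dist_L M d L x y" "dist_L M d L x y \<le> d x y + 2"
proof -
  have "0 \<le> dist_L M d L x y \<and> dist_L M d L x y \<le> d x y + 2"
  proof (cases "x = y")
    case True
    then show ?thesis using dist_L_self by (simp add: add_nonneg_nonneg)
  next
    case False
    then obtain c where "L_chain M d L c" "chain_separates M d c {x} {y}"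
      "dist_L M d L x y = 1 + real (card c)"
      using dist_L_attained(1)[OF assms] by blast
    then show ?thesis using card_chain_separating_le[OF _ _ assms, of c] unfolding L_chain_def by simp
  qed
  then show "0 \<le> dist_L M d L x y" "dist_L M d L x y \<le> d x y + 2" by auto
qed

section \<open>Chains that cross a geodesic\<close>

text \<open>
  Halfspaces are not convex, so a geodesic may pass through a curtain several times. \<open>L\<close>-separation limits
  this: a curtain that separates two points of a geodesic, and is preceded by enough others doing so,
  also has the initial point of the geodesic behind it.
\<close>

lemma nested_no_backtracking:
  assumes n: "nested_curtains n h N P"
    and L: "\<And>i j. i < n \<Longrightarrow> j < n \<Longrightarrow> i \<noteq> j \<Longrightarrow> L_separated M d L (h i) (h j)"
    and \<alpha>: "geodesic M d {0..l} \<alpha>" and t: "0 \<le> t'" "t' \<le> t''" "t'' \<le> l"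
    and NP: "\<And>i. i < n \<Longrightarrow> \<alpha> t' \<in> N i \<and> \<alpha> t'' \<in> P i"
    and i: "2 * L + 8 \<le> i" "i < n"
  shows "\<alpha> 0 \<in> N i"
proof (rule ccontr)
  assume neg: "\<alpha> 0 \<notin> N i"
  \<comment> \<open>If \<open>\<alpha> 0\<close> were not behind the \<open>i\<close>-th curtain, the curtains before it would separate \<open>\<alpha> t'\<close> from
    both \<open>\<alpha> 0\<close> and \<open>\<alpha> t''\<close>. Going back from \<open>\<alpha> t'\<close>, the geodesic meets the \<open>j\<close>-th of them at
    distance at least \<open>j - 1 > 2 L + 4\<close> from \<open>\<alpha> t'\<close>, yet by the bottleneck within \<open>2 L + 4\<close> of the part
    beyond \<open>\<alpha> t'\<close>.\<close>
  define j where "j = 2 * L + 6"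
  have j: "j - 1 < j" "j < j + 1" "j + 1 < i" "j - 1 < i" "j < i" "j - 1 < n" "j < n" "j + 1 < n"
    using i by (auto simp: j_def)
  have z: "0 \<in> {0..l}" "t' \<in> {0..l}" "t'' \<in> {0..l}" using t by auto
  have "\<alpha> 0 \<in> h i \<union> P i"
    using neg sides_partition(1)[OF nested_curtains_sides[OF n i(2)]] geodesic_in[OF \<alpha> z(1)] by blast
  then have P0: "\<alpha> 0 \<in> P k" if "k < i" for k
    using nested_curtains_less(3,4)[OF n that i(2)] by blast
  note s = nested_curtains_sides[OF n]
  have sub: "{t'..t''} \<subseteq> {0..l}" "{0..t'} \<subseteq> {0..l}" using t by auto
  have g1: "geodesic M d {0..t'' - t'} (\<lambda>s. \<alpha> (t' + s))"
    by (rule geodesic_shift[OF geodesic_restrict[OF \<alpha> sub(1) is_interval_cc]])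
  have g2: "geodesic M d {0..t'} (\<lambda>s. \<alpha> (t' - s))"
    by (rule geodesic_reverse[OF geodesic_restrict[OF \<alpha> sub(2) is_interval_cc]])
  have P't: "\<alpha> t' \<in> N k" "\<alpha> t'' \<in> P k" if "k < n" for k using NP[OF that] by auto
  obtain v where v: "0 \<le> v" "v \<le> t'" "\<alpha> (t' - v) \<in> h j"
    using geodesic_meets_curtain[OF s[OF j(7)] g2 t(1)] P't(1)[OF j(7)] P0[OF j(5)] by auto
  have "\<exists>s\<in>{0..t'' - t'}. d (\<alpha> (t' - v)) (\<alpha> (t' + s)) \<le> 2 * real L + 4"
  proof (rule bottleneck[OF s[OF j(6)] s[OF j(7)] s[OF j(8)], where \<beta> = "\<lambda>s. \<alpha> (t' - s)" and m = t'])
    show "h j \<subseteq> P (j - 1)" by (rule nested_curtains_less(3)[OF n j(1,7)])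
    show "h j \<subseteq> N (j + 1)" by (rule nested_curtains_less(1)[OF n j(2,8)])
    show "L_separated M d L (h (j - 1)) (h j)" by (rule L[OF j(6,7)]) (use j(1) in simp)
    show "L_separated M d L (h j) (h (j + 1))" by (rule L[OF j(7,8)]) simp
    show "\<alpha> (t' + 0) \<in> N (j - 1) \<inter> N j \<inter> N (j + 1)"
      using P't(1)[OF j(6)] P't(1)[OF j(7)] P't(1)[OF j(8)] by simp
    show "\<alpha> (t' + (t'' - t')) \<in> P (j - 1) \<inter> P j \<inter> P (j + 1)"
      using P't(2)[OF j(6)] P't(2)[OF j(7)] P't(2)[OF j(8)] by simp
    show "\<alpha> (t' - 0) \<in> N (j - 1)" using P't(1)[OF j(6)] by simp
    show "\<alpha> (t' - t') \<in> P (j + 1)" using P0[OF j(3)] by simp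
    show "v \<in> {0..t'}" "\<alpha> (t' - v) \<in> h j" using v by auto
  qed (use g1 g2 t(2) in auto)
  then obtain s where s0: "s \<in> {0..t'' - t'}" "d (\<alpha> (t' - v)) (\<alpha> (t' + s)) \<le> 2 * real L + 4"
    by blast
  have in_l: "t' - v \<in> {0..l}" "t' + s \<in> {0..l}" using v t s0(1) by auto
  have "d (\<alpha> (t' - v)) (\<alpha> (t' + s)) = v + s"
    unfolding geodesic_dist[OF \<alpha> in_l] using v(1) s0(1) by simp
  then have "v \<le> 2 * real L + 4" using s0 by simp
  moreover have "d (\<alpha> t') (\<alpha> (t' - v)) = v"
    unfolding geodesic_dist[OF \<alpha> z(2) in_l(1)] using v(1) by simp
  moreover have "real (card {..<j}) \<le> d (\<alpha> t') (\<alpha> (t' - v)) + 1"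
  proof (rule card_nested_separating_le[OF n])
    show "{..<j} \<subseteq> {..<n}" using j(7) by auto
    show "\<alpha> t' \<in> M" "\<alpha> (t' - v) \<in> M" using geodesic_in[OF \<alpha>] z(2) in_l(1) by auto
    show "\<alpha> t' \<in> N k \<and> \<alpha> (t' - v) \<in> P k" if "k \<in> {..<j}" for k
    proof -
      have "k < j" using that by simp
      then show ?thesis
        using P't(1)[of k] nested_curtains_less(3)[OF n \<open>k < j\<close> j(7)] v(3) j(7) by auto
    qed
  qed
  ultimately show False by (simp add: j_def)
qed

lemma bottleneck_nested:
  assumes n: "nested_curtains n h N P"
    and L: "\<And>i j. i < n \<Longrightarrow> j < n \<Longrightarrow> i \<noteq> j \<Longrightarrow> L_separated M d L (h i) (h j)"
    and i: "i + 2 < n"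
    and \<alpha>: "geodesic_segment M d x y S" "x \<in> N i" "x \<in> N (i + 1)" "x \<in> N (i + 2)"
      "y \<in> P i" "y \<in> P (i + 1)" "y \<in> P (i + 2)"
    and \<beta>: "geodesic M d {0..m} \<beta>" "\<beta> 0 \<in> N i" "\<beta> m \<in> P (i + 2)"
    and t: "t \<in> {0..m}" "\<beta> t \<in> h (i + 1)"
  shows "\<exists>z\<in>S. d (\<beta> t) z \<le> 2 * real L + 4"
proof -
  obtain \<gamma> where \<gamma>: "geodesic M d {0..d x y} \<gamma>" "\<gamma> 0 = x" "\<gamma> (d x y) = y" "S = \<gamma> ` {0..d x y}"
    using \<alpha>(1) unfolding geodesic_segment_def by blast
  have j: "i < i + 1" "i + 1 < i + 2" "i < n" "i + 1 < n" "i + 2 < n" using i by auto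
  note s = nested_curtains_sides[OF n]
  have "\<exists>s\<in>{0..d x y}. d (\<beta> t) (\<gamma> s) \<le> 2 * real L + 4"
  proof (rule bottleneck[OF s[OF j(3)] s[OF j(4)] s[OF j(5)] _ _ _ _ \<gamma>(1) _ _ _ \<beta> t])
    show "h (i + 1) \<subseteq> P i" by (rule nested_curtains_less(3)[OF n j(1,4)])
    show "h (i + 1) \<subseteq> N (i + 2)" by (rule nested_curtains_less(1)[OF n j(2,5)])
    show "L_separated M d L (h i) (h (i + 1))" by (rule L[OF j(3,4)]) simp
    show "L_separated M d L (h (i + 1)) (h (i + 2))" by (rule L[OF j(4,5)]) simp
    show "\<gamma> 0 \<in> N i \<inter> N (i + 1) \<inter> N (i + 2)" unfolding \<gamma>(2) using \<alpha>(2-4) by blast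
    show "\<gamma> (d x y) \<in> P i \<inter> P (i + 1) \<inter> P (i + 2)" unfolding \<gamma>(3) using \<alpha>(5-7) by blast
  qed simp
  then show ?thesis unfolding \<gamma>(4) by blast
qed

text \<open>
  Let \<open>x\<close> be a point in the middle of a side \<open>[p,q]\<close> of a triangle. A long piece of the side around \<open>x\<close> has
  ends that are far apart also for \<open>d\<^sub>L\<close>, hence is crossed by a long \<open>L\<close>-chain. Apart from boundedly many
  members the chain separates \<open>p\<close> from \<open>q\<close>. The third vertex \<open>r\<close> lies on one side of three consecutive
  members, so these separate \<open>p\<close> from \<open>q\<close> and \<open>r\<close>, or \<open>q\<close> from \<open>p\<close> and \<open>r\<close>, and the bottleneck brings a nearby
  point of \<open>[p,q]\<close> close to the side joining the separated vertex to \<open>r\<close>.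
\<close>

lemma hyperbolic_if_dist_L_large:
  assumes K: "1 \<le> K" "0 \<le> C" and le: "\<And>x y. x \<in> M \<Longrightarrow> y \<in> M \<Longrightarrow> d x y \<le> K * dist_L M d L x y + C"
  shows "hyperbolic_space M d"
proof -
  \<comment> \<open>The first and the last \<open>i0\<close> curtains may fail to separate the ends of the side; the third vertex
    lies on one side of the first three or of the last three of the six that remain. \<open>R\<close> is
    half the length of a piece of the side that is crossed by so many curtains.\<close>
  define i0 where "i0 = 2 * L + 8"
  define n where "n = 2 * i0 + 6"
  define R where "R = (K * (real n + 3) + C) / 2"
  define B where "B = 2 * real L + 4"
  have R: "0 < R" "2 * R = K * (real n + 3) + C"
  proof -
    have "0 < K * (real n + 3)" using K(1) by simp
    then show "0 < R" "2 * R = K * (real n + 3) + C" using K(2) by (auto simp: R_def)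
  qed
  have main: "\<exists>y\<in>T \<union> U. d x y \<le> R + B"
    if pqr: "p \<in> M" "q \<in> M" "r \<in> M" and S: "geodesic_segment M d p q S"
      and T: "geodesic_segment M d p r T" and U: "geodesic_segment M d q r U" and x: "x \<in> S"
    for p q r S T U x
  proof -
    define l where "l = d p q"
    obtain \<alpha> where \<alpha>: "geodesic M d {0..l} \<alpha>" "\<alpha> 0 = p" "\<alpha> l = q" "S = \<alpha> ` {0..l}"
      using S unfolding geodesic_segment_def l_def by blast
    obtain t where t: "t \<in> {0..l}" "x = \<alpha> t" using x \<alpha>(4) by blast
    have zl: "0 \<in> {0..l}" "l \<in> {0..l}" by (auto simp: l_def)
    have pT: "p \<in> T" and qU: "q \<in> U"
      using T U unfolding geodesic_segment_def by (force intro: image_eqI[of _ _ 0])+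
    have B0: "0 \<le> B" by (simp add: B_def)
    consider "t \<le> R" | "l - t \<le> R" | "R < t" "R < l - t" by linarith
    then show ?thesis
    proof cases
      case 1
      then have "d x p \<le> R" using geodesic_dist[OF \<alpha>(1) t(1) zl(1)] t by (simp add: \<alpha>(2))
      then have "d x p \<le> R + B" using B0 by linarith
      then show ?thesis using pT by blast
    next
      case 2
      then have "d x q \<le> R" using geodesic_dist[OF \<alpha>(1) t(1) zl(2)] t by (simp add: \<alpha>(3))
      then have "d x q \<le> R + B" using B0 by linarith
      then show ?thesis using qU by blast
    next
      case 3
      define t' t'' where "t' = t - R" and "t'' = t + R"
      have tt: "0 \<le> t'" "t' \<le> t''" "t'' \<le> l" "t' \<in> {0..l}" "t'' \<in> {0..l}"
        using 3 R(1) by (auto simp: t'_def t''_def)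
      have tM: "\<alpha> t' \<in> M" "\<alpha> t'' \<in> M" using geodesic_in[OF \<alpha>(1)] tt(4,5) by auto
      have dt: "d (\<alpha> t') (\<alpha> t'') = 2 * R"
        unfolding geodesic_dist[OF \<alpha>(1) tt(4,5)] using R(1) by (simp add: t'_def t''_def)
      have "\<alpha> t' \<noteq> \<alpha> t''"
      proof
        assume "\<alpha> t' = \<alpha> t''"
        then have "d (\<alpha> t') (\<alpha> t'') = 0" using tM by simp
        then show False using dt R(1) by simp
      qed
      then obtain c where c: "L_chain M d L c" "chain_separates M d c {\<alpha> t'} {\<alpha> t''}"
        "dist_L M d L (\<alpha> t') (\<alpha> t'') = 1 + real (card c)"
        using dist_L_attained(1)[OF tM] by blast
      have "K * (real n + 3) \<le> K * (1 + real (card c))"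
        using le[OF tM] unfolding dt c(3) R(2) by linarith
      then have "n + 2 \<le> card c" using K(1) by simp
      then obtain h N P where n: "nested_curtains n h N P"
        and NP: "\<And>i. i < n \<Longrightarrow> \<alpha> t' \<in> N i \<and> \<alpha> t'' \<in> P i"
        and L: "\<And>i j. i < n \<Longrightarrow> j < n \<Longrightarrow> i \<noteq> j \<Longrightarrow> L_separated M d L (h i) (h j)"
        using L_chain_nested[OF c(1,2)] by blast
      have pN: "p \<in> N i" if "i0 \<le> i" "i < n" for i
        using nested_no_backtracking[OF n L \<alpha>(1) tt(1-3) NP] that unfolding i0_def \<alpha>(2) by blast
      have qP: "q \<in> P i" if "i + i0 < n" for i
      proof -
        have i: "i0 \<le> n - 1 - i" "n - 1 - i < n" "n - 1 - (n - 1 - i) = i" using that by auto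
        have "(\<lambda>s. \<alpha> (l - s)) 0 \<in> P (n - 1 - (n - 1 - i))"
        proof (rule nested_no_backtracking[OF nested_curtains_reverse[OF n] _ geodesic_reverse[OF \<alpha>(1)],
              where t' = "l - t''" and t'' = "l - t'"])
          show "L_separated M d L (h (n - 1 - i)) (h (n - 1 - j))" if "i < n" "j < n" "i \<noteq> j" for i j
            by (rule L) (use that in auto)
          show "\<alpha> (l - (l - t'')) \<in> P (n - 1 - k) \<and> \<alpha> (l - (l - t')) \<in> N (n - 1 - k)" if "k < n" for k
            using NP[of "n - 1 - k"] that by simp
        qed (use tt i in \<open>auto simp: i0_def\<close>)
        then show ?thesis unfolding i(3) by (simp add: \<alpha>(3))
      qed
      have sub: "{t'..t''} \<subseteq> {0..l}" using tt by auto
      have mid: "\<exists>s\<in>{0..l}. \<alpha> s \<in> h i \<and> d x (\<alpha> s) \<le> R" if i: "i < n" for i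
      proof -
        obtain s where s: "t' \<le> s" "s \<le> t''" "\<alpha> s \<in> h i"
          using geodesic_meets_curtain[OF nested_curtains_sides[OF n i]
              geodesic_restrict[OF \<alpha>(1) sub is_interval_cc] tt(2)] NP[OF i] by blast
        have sl: "s \<in> {0..l}" using s tt by auto
        have "d x (\<alpha> s) \<le> R"
          unfolding t(2) geodesic_dist[OF \<alpha>(1) t(1) sl] using s by (auto simp: t'_def t''_def)
        then show ?thesis using s(3) sl by blast
      qed
      have close: "\<exists>z\<in>V. d x z \<le> R + B"
        if i: "i0 \<le> i" "i + 2 + i0 < n" and V: "geodesic_segment M d u v V"
          and u: "\<And>k. i \<le> k \<Longrightarrow> k \<le> i + 2 \<Longrightarrow> u \<in> N k" and v: "\<And>k. i \<le> k \<Longrightarrow> k \<le> i + 2 \<Longrightarrow> v \<in> P k"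
        for u v V i
      proof -
        obtain s where s: "s \<in> {0..l}" "\<alpha> s \<in> h (i + 1)" "d x (\<alpha> s) \<le> R"
          using mid[of "i + 1"] i by auto
        have 2: "i + 2 < n" using i by simp
        have "\<alpha> 0 \<in> N i" "\<alpha> l \<in> P (i + 2)" using pN[of i] qP[of "i + 2"] i \<alpha>(2,3) by auto
        then obtain z where z: "z \<in> V" "d (\<alpha> s) z \<le> B"
          using bottleneck_nested[OF n L 2 V _ _ _ _ _ _ \<alpha>(1) _ _ s(1,2)] u[of i] u[of "i + 1"] u[of "i + 2"]
            v[of i] v[of "i + 1"] v[of "i + 2"] unfolding B_def by auto
        have zM: "z \<in> M" using geodesic_segment_subset[OF V] z(1) by blast
        have "d x z \<le> d x (\<alpha> s) + d (\<alpha> s) z"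
          by (rule triangle[OF _ _ zM]) (use geodesic_in[OF \<alpha>(1)] t s(1) in auto)
        then have "d x z \<le> R + B" using s(3) z(2) by linarith
        then show ?thesis using z(1) by blast
      qed
      have i3: "i0 + 3 < n" by (simp add: n_def)
      show ?thesis
      proof (cases "r \<in> N (i0 + 3)")
        case True
        have "\<exists>z\<in>U. d x z \<le> R + B"
        proof (rule close[of "i0 + 3", OF _ _ geodesic_segment_commute[OF U]])
          fix k assume k: "i0 + 3 \<le> k" "k \<le> i0 + 3 + 2"
          then have kn: "k < n" "k + i0 < n" by (auto simp: n_def)
          show "q \<in> P k" by (rule qP[OF kn(2)])
          show "r \<in> N k"
            using True nested_curtains_less(2)[OF n _ kn(1), of "i0 + 3"] k(1) by (cases "k = i0 + 3") auto
        qed (auto simp: n_def)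
        then show ?thesis by blast
      next
        case False
        then have r: "r \<in> h (i0 + 3) \<union> P (i0 + 3)"
          using sides_partition(1)[OF nested_curtains_sides[OF n i3]] pqr(3) by blast
        have "\<exists>z\<in>T. d x z \<le> R + B"
        proof (rule close[of i0, OF _ _ T])
          fix k assume k: "i0 \<le> k" "k \<le> i0 + 2"
          then have "k < i0 + 3" by simp
          then show "r \<in> P k" using r nested_curtains_less(3,4)[OF n _ i3] by blast
          show "p \<in> N k" by (rule pN) (use k in \<open>auto simp: n_def\<close>)
        qed (auto simp: n_def)
        then show ?thesis by blast
      qed
    qed
  qed
  have "0 \<le> R + B" using R(1) by (simp add: B_def)
  then show ?thesis
    unfolding hyperbolic_space_def using main by (intro exI[of _ "R + B"]) blast
qed


section \<open>Curtains in hyperbolic spaces\<close>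

definition slim_triangles :: "real \<Rightarrow> bool" where
  "slim_triangles \<delta> \<longleftrightarrow> (\<forall>p\<in>M. \<forall>q\<in>M. \<forall>r\<in>M. \<forall>S T U.
     geodesic_segment M d p q S \<and> geodesic_segment M d p r T \<and> geodesic_segment M d q r U \<longrightarrow>
     (\<forall>x\<in>S. \<exists>y\<in>T \<union> U. d x y \<le> \<delta>))"

lemma hyperbolic_space_iff: "hyperbolic_space M d \<longleftrightarrow> (\<exists>\<delta>\<ge>0. slim_triangles \<delta>)"
  unfolding hyperbolic_space_def slim_triangles_def ..

text \<open>
  Cut the quadrilateral by the diagonal from \<open>a\<close> to \<open>v\<close>.
\<close>

lemma slim_quadrilateral:
  assumes \<delta>: "slim_triangles \<delta>" and M: "a \<in> M" "b \<in> M" "u \<in> M" "v \<in> M"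
    and S: "geodesic_segment M d a b S" and T: "geodesic_segment M d a u T"
    and V: "geodesic_segment M d u v V" and W: "geodesic_segment M d v b W"
    and x: "x \<in> S"
  shows "\<exists>y\<in>T \<union> V \<union> W. d x y \<le> 2 * \<delta>"
proof -
  obtain D where D: "geodesic_segment M d a v D"
    using geodesic_exists[OF M(1,4)] by blast
  note slim = \<delta>[unfolded slim_triangles_def, rule_format]
  have xM: "x \<in> M" using geodesic_segment_subset[OF S] x by blast
  obtain y where y: "y \<in> D \<union> W" "d x y \<le> \<delta>"
    using slim[OF M(1,2,4), of S D W x] S D geodesic_segment_commute[OF W] x by blast
  have d0: "0 \<le> \<delta>" using y(2) nonneg[of x y] by linarith
  show ?thesis
  proof (cases "y \<in> W")
    case True
    have "d x y \<le> 2 * \<delta>" using y(2) d0 by linarith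
    then show ?thesis using True by blast
  next
    case False
    then have yD: "y \<in> D" using y(1) by blast
    obtain z where z: "z \<in> T \<union> V" "d y z \<le> \<delta>"
      using slim[OF M(1,4,3), of D T V y] D T geodesic_segment_commute[OF V] yD by blast
    have "y \<in> M" "z \<in> M"
      using geodesic_segment_subset[OF D] geodesic_segment_subset[OF T] geodesic_segment_subset[OF V]
        yD z(1) by blast+
    then have "d x z \<le> d x y + d y z" using triangle[OF xM] by blast
    then have "d x z \<le> 2 * \<delta>" using y(2) z(2) by linarith
    then show ?thesis using z(1) by blast
  qed
qed

lemma geodesic_segment_along:
  assumes \<alpha>: "geodesic M d I \<alpha>" and ab: "a \<in> I" "b \<in> I"
  shows "geodesic_segment M d (\<alpha> a) (\<alpha> b) (\<alpha> ` {min a b..max a b})"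
proof -
  have *: "geodesic_segment M d (\<alpha> a) (\<alpha> b) (\<alpha> ` {a..b})" if "a \<le> b" "a \<in> I" "b \<in> I" for a b
  proof -
    have "{a..b} \<subseteq> I" using geodesic_between[OF \<alpha> that(2,3)] by (meson atLeastAtMost_iff subsetI)
    then have g: "geodesic M d {0..b - a} (\<lambda>s. \<alpha> (a + s))"
      by (rule geodesic_shift[OF geodesic_restrict[OF \<alpha> _ is_interval_cc]])
    have "geodesic_segment M d (\<alpha> a) (\<alpha> b) ((\<lambda>s. \<alpha> (a + s)) ` {0..b - a})"
      by (rule geodesic_segmentI(1)[OF g]) (use that(1) in auto)
    moreover have "(\<lambda>s. \<alpha> (a + s)) ` {0..b - a} = \<alpha> ` ((+) a ` {0..b - a})"
      by (simp only: image_image)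
    moreover have "(+) a ` {0..b - a} = {a..b}" by (simp add: image_add_atLeastAtMost)
    ultimately show ?thesis by (simp only:)
  qed
  show ?thesis
  proof (cases "a \<le> b")
    case True
    then show ?thesis using *[OF True ab] by simp
  next
    case False
    then have "b \<le> a" by simp
    then show ?thesis using geodesic_segment_commute[OF *[OF \<open>b \<le> a\<close> ab(2,1)]] by simp
  qed
qed

lemma foot_on_segment_to_foot:
  assumes I: "complete_geodesic I \<alpha>" and x: "x \<in> M"
    and S: "geodesic_segment M d x (\<alpha> (foot I \<alpha> x)) S" and z: "z \<in> S"
  shows "foot I \<alpha> z = foot I \<alpha> x"
proof -
  define l where "l = d x (\<alpha> (foot I \<alpha> x))"
  obtain \<gamma> where \<gamma>: "geodesic M d {0..l} \<gamma>" "\<gamma> 0 = x" "\<gamma> l = \<alpha> (foot I \<alpha> x)" "S = \<gamma> ` {0..l}"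
    using S unfolding geodesic_segment_def l_def by blast
  obtain s where s: "s \<in> {0..l}" "z = \<gamma> s" using z \<gamma>(4) by blast
  show ?thesis unfolding s(2) by (rule foot_on_segment[OF I x \<gamma>(1-3) s(1)])
qed

lemma geodesic_segment_exists:
  assumes "x \<in> M" "y \<in> M"
  obtains S where "geodesic_segment M d x y S"
  using geodesic_exists[OF assms] by blast

text \<open>
  Choose \<open>a\<close> and \<open>b\<close> in \<open>k\<close>, one in each of the two curtains. The quadrilateral formed by \<open>a\<close>, \<open>b\<close> and their feet on
  \<open>\<alpha>\<close> brings the midpoint close to \<open>[a,b]\<close>, because the sides at the feet project to points of \<open>\<alpha>\<close> far from
  it. Curtains are not convex, but the path from \<open>a\<close> to its foot on the pole of \<open>k\<close>, along the pole and on to \<open>b\<close>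
  stays in \<open>k\<close>, and it forms a second slim quadrilateral with \<open>[a,b]\<close>.
\<close>

lemma curtain_passes_near_midpoint:
  assumes \<delta>: "slim_triangles \<delta>" "0 \<le> \<delta>"
    and h: "dual_at M d h I \<alpha> r" and h': "dual_at M d h' I \<alpha> s" and rs: "r + (8 * \<delta> + 2) \<le> s"
    and k: "curtain M d k" "k \<inter> h \<noteq> {}" "k \<inter> h' \<noteq> {}"
  shows "\<exists>w\<in>k. d (\<alpha> ((r + s) / 2)) w \<le> 4 * \<delta>"
proof -
  obtain a b where a: "a \<in> k" "a \<in> h" and b: "b \<in> k" "b \<in> h'" using k(2,3) by blast
  note I = dual_at_complete(1)[OF h]
  note \<alpha> = dual_at_complete(4)[OF h]
  define fa fb where "fa = foot I \<alpha> a" and "fb = foot I \<alpha> b"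
  have aM: "a \<in> M" and fa: "fa \<in> {r - 1/2..r + 1/2}"
    using a(2) unfolding dual_at_foot(1)[OF h] fa_def by auto
  have bM: "b \<in> M" and fb: "fb \<in> {s - 1/2..s + 1/2}"
    using b(2) unfolding dual_at_foot(1)[OF h'] fb_def by auto
  have fI: "fa \<in> I" "fb \<in> I" unfolding fa_def fb_def using foot_in[OF I] aM bM by auto
  define c where "c = (r + s) / 2"
  have c: "fa + (4 * \<delta> + 1/2) \<le> c" "c + (4 * \<delta> + 1/2) \<le> fb"
    using fa fb rs unfolding c_def by (simp_all add: field_simps)
  have cI: "c \<in> I" by (rule geodesic_between[OF \<alpha> fI]) (use c \<delta>(2) in auto)
  define m where "m = \<alpha> c"
  have mM: "m \<in> M" unfolding m_def by (rule geodesic_in[OF \<alpha> cI])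
  have M: "\<alpha> fa \<in> M" "\<alpha> fb \<in> M" using geodesic_in[OF \<alpha>] fI by auto
  have S: "geodesic_segment M d (\<alpha> fa) (\<alpha> fb) (\<alpha> ` {min fa fb..max fa fb})"
    by (rule geodesic_segment_along[OF \<alpha> fI])
  have mS: "m \<in> \<alpha> ` {min fa fb..max fa fb}"
    unfolding m_def using c \<delta>(2) by (intro imageI) auto
  obtain T where T: "geodesic_segment M d a (\<alpha> fa) T" by (rule geodesic_segment_exists[OF aM M(1)])
  obtain W where W: "geodesic_segment M d b (\<alpha> fb) W" by (rule geodesic_segment_exists[OF bM M(2)])
  obtain V where V: "geodesic_segment M d a b V" by (rule geodesic_segment_exists[OF aM bM])
  obtain y where y: "y \<in> T \<union> V \<union> W" "d m y \<le> 2 * \<delta>"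
    using slim_quadrilateral[OF \<delta>(1) M aM bM S geodesic_segment_commute[OF T] V W mS] by blast
  have yM: "y \<in> M"
    using y(1) geodesic_segment_subset[OF T] geodesic_segment_subset[OF V] geodesic_segment_subset[OF W]
    by blast
  have fm: "foot I \<alpha> m = c" unfolding m_def by (rule foot_on_geodesic[OF I cI])
  have near: "\<bar>c - foot I \<alpha> y\<bar> \<le> 2 * \<delta>"
    using foot_nonexpansive[OF I mM yM] y(2) unfolding fm by linarith
  have "y \<notin> T"
  proof
    assume "y \<in> T"
    then have "foot I \<alpha> y = fa"
      using foot_on_segment_to_foot[OF I aM _ \<open>y \<in> T\<close>] T unfolding fa_def by blast
    then show False using near c \<delta>(2) by linarith
  qed
  moreover have "y \<notin> W"
  proof
    assume "y \<in> W"
    then have "foot I \<alpha> y = fb"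
      using foot_on_segment_to_foot[OF I bM _ \<open>y \<in> W\<close>] W unfolding fb_def by blast
    then show False using near c \<delta>(2) by linarith
  qed
  ultimately have yV: "y \<in> V" using y(1) by blast
  \<comment> \<open>So the side \<open>[a,b]\<close> passes near \<open>m\<close>. It is replaced by a path inside \<open>k\<close>, through the pole.\<close>
  obtain J \<kappa> q where \<kappa>: "dual_at M d k J \<kappa> q" using k(1) unfolding curtain_def by blast
  note J = dual_at_complete(1)[OF \<kappa>]
  note g = dual_at_complete(4)[OF \<kappa>]
  note kdef = dual_at_foot(1)[OF \<kappa>]
  define ga gb where "ga = foot J \<kappa> a" and "gb = foot J \<kappa> b"
  have gab: "ga \<in> {q - 1/2..q + 1/2}" "gb \<in> {q - 1/2..q + 1/2}"
    using a(1) b(1) unfolding kdef ga_def gb_def by auto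
  have gJ: "ga \<in> J" "gb \<in> J" unfolding ga_def gb_def using foot_in[OF J] aM bM by auto
  have gM: "\<kappa> ga \<in> M" "\<kappa> gb \<in> M" using geodesic_in[OF g] gJ by auto
  obtain A where A: "geodesic_segment M d a (\<kappa> ga) A" by (rule geodesic_segment_exists[OF aM gM(1)])
  obtain B where B: "geodesic_segment M d b (\<kappa> gb) B" by (rule geodesic_segment_exists[OF bM gM(2)])
  define D where "D = \<kappa> ` {min ga gb..max ga gb}"
  have D: "geodesic_segment M d (\<kappa> ga) (\<kappa> gb) D"
    unfolding D_def by (rule geodesic_segment_along[OF g gJ])
  obtain w where w: "w \<in> A \<union> D \<union> B" "d y w \<le> 2 * \<delta>"
    using slim_quadrilateral[OF \<delta>(1) aM bM gM V A D geodesic_segment_commute[OF B] yV] by blast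
  have wM: "w \<in> M"
    using w(1) geodesic_segment_subset[OF A] geodesic_segment_subset[OF D] geodesic_segment_subset[OF B]
    by blast
  have "foot J \<kappa> w \<in> {q - 1/2..q + 1/2}"
    using w(1)
  proof (elim UnE)
    assume wA: "w \<in> A"
    have "foot J \<kappa> w = ga"
      using foot_on_segment_to_foot[OF J aM _ wA] A unfolding ga_def by blast
    then show ?thesis using gab(1) by simp
  next
    assume "w \<in> D"
    then obtain e where e: "e \<in> {min ga gb..max ga gb}" "w = \<kappa> e" unfolding D_def by blast
    have eq: "e \<in> {q - 1/2..q + 1/2}" using e(1) gab by auto
    then have "e \<in> J" using dual_at_complete(2)[OF \<kappa>] by blast
    then show ?thesis unfolding e(2) using foot_on_geodesic[OF J] eq by simp
  next
    assume wB: "w \<in> B"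
    have "foot J \<kappa> w = gb"
      using foot_on_segment_to_foot[OF J bM _ wB] B unfolding gb_def by blast
    then show ?thesis using gab(2) by simp
  qed
  then have "w \<in> k" unfolding kdef using wM by simp
  moreover have "d m w \<le> 4 * \<delta>"
    using triangle[OF mM yM wM] y(2) w(2) by linarith
  ultimately show ?thesis unfolding m_def c_def by blast
qed

text \<open>
  All curtains that meet both \<open>h\<close> and \<open>h'\<close> come close to one point, so a chain of them has its ends within
  bounded distance of each other while its interior members separate the ends.
\<close>

lemma far_dual_curtains_L_separated:
  assumes \<delta>: "slim_triangles \<delta>" "0 \<le> \<delta>"
    and h: "dual_at M d h I \<alpha> r" and h': "dual_at M d h' I \<alpha> s" and rs: "r + (8 * \<delta> + 2) \<le> s"
    and L: "8 * \<delta> + 5 \<le> real L"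
  shows "L_separated M d L h h'"
  unfolding L_separated_def
proof (intro conjI allI impI)
  show "curtain M d h" "curtain M d h'" unfolding curtain_def using h h' by blast+
  show "h \<inter> h' = {}"
    unfolding dual_at_foot(1)[OF h] dual_at_foot(1)[OF h'] using rs \<delta>(2) by auto
  define m where "m = \<alpha> ((r + s) / 2)"
  have mM: "m \<in> M"
  proof -
    have "r \<in> I" "s \<in> I"
      using dual_at_complete(2)[OF h] dual_at_complete(2)[OF h'] by (auto simp: subset_iff)
    then have "(r + s) / 2 \<in> I"
      by (rule geodesic_between[OF dual_at_complete(4)[OF h]]) (use rs \<delta>(2) in auto)
    then show ?thesis unfolding m_def by (rule geodesic_in[OF dual_at_complete(4)[OF h]])
  qed
  fix c assume c: "curtain_chain M d c \<and> (\<forall>k\<in>c. k \<inter> h \<noteq> {} \<and> k \<inter> h' \<noteq> {})"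
  have "\<not> (infinite c \<or> (L - 1) + 2 \<le> card c)"
  proof
    assume big: "infinite c \<or> (L - 1) + 2 \<le> card c"
    define n where "n = L - 1"
    have n1: "8 * \<delta> + 4 \<le> real n" using L \<delta>(2) by (simp add: n_def of_nat_diff)
    then have n4: "4 \<le> n" using \<delta>(2) by linarith
    obtain k N P where n: "nested_curtains n k N P" "k ` {..<n} \<subseteq> c"
      using curtain_chain_nested[OF _ big[folded n_def]] c by blast
    have near: "\<exists>w. w \<in> k i \<and> w \<in> M \<and> d m w \<le> 4 * \<delta>" if i: "i < n" for i
    proof -
      have "k i \<in> c" using n(2) i by auto
      then have meet: "k i \<inter> h \<noteq> {}" "k i \<inter> h' \<noteq> {}" using c by auto
      have s: "sides (k i) (N i) (P i)" by (rule nested_curtains_sides[OF n(1) i])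
      then have "curtain M d (k i)" unfolding curtain_iff by blast
      then show ?thesis
        using curtain_passes_near_midpoint[OF \<delta> h h' rs _ meet] sides_partition(1)[OF s]
        unfolding m_def by blast
    qed
    obtain x where x: "x \<in> k 0" "x \<in> M" "d m x \<le> 4 * \<delta>" using near[of 0] n4 by auto
    obtain y where y: "y \<in> k (n - 1)" "y \<in> M" "d m y \<le> 4 * \<delta>" using near[of "n - 1"] n4 by auto
    have "real (card {1..<n - 1}) \<le> d x y + 1"
    proof (rule card_nested_separating_le[OF n(1) _ _ x(2) y(2)])
      show "{1..<n - 1} \<subseteq> {..<n}" by auto
      show "x \<in> N i \<and> y \<in> P i" if "i \<in> {1..<n - 1}" for i
      proof -
        have i: "0 < i" "i < n" "i < n - 1" "n - 1 < n" using that n4 by auto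
        show ?thesis
          using nested_curtains_less(1)[OF n(1) i(1,2)] nested_curtains_less(3)[OF n(1) i(3,4)] x(1) y(1)
          by blast
      qed
    qed
    moreover have "d x y \<le> 8 * \<delta>"
      using triangle''[OF x(2) mM y(2)] x(3) y(3) by (simp add: commute)
    moreover have "real (card {1..<n - 1}) = real n - 2" using n4 by simp
    ultimately show False using n1 by linarith
  qed
  moreover have "1 \<le> L" using L \<delta>(2) by linarith
  ultimately show "finite c" "card c \<le> L" by auto
qed

lemma dist_L_lower_bound:
  assumes \<delta>: "slim_triangles \<delta>" "0 \<le> \<delta>" and L: "8 * \<delta> + 5 \<le> real L" and xy: "x \<in> M" "y \<in> M"
  shows "d x y / (8 * \<delta> + 2) - 1 \<le> dist_L M d L x y"
proof (cases "x = y")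
  case True
  then show ?thesis using xy by (simp add: dist_L_self)
next
  case False
  define l T where "l = d x y" and "T = 8 * \<delta> + 2"
  have T: "2 \<le> T" using \<delta>(2) by (simp add: T_def)
  obtain \<alpha> where \<alpha>: "geodesic M d {0..l} \<alpha>" "\<alpha> 0 = x" "\<alpha> l = y"
    using geodesic_exists[OF xy] unfolding l_def by blast
  have l0: "0 \<le> l" by (simp add: l_def)
  have I: "complete_geodesic {0..l} \<alpha>" by (rule complete_geodesic_Icc[OF \<alpha>(1) l0])
  \<comment> \<open>Curtains at the positions \<open>1, 1 + T, 1 + 2 T, \<dots>\<close>; length 2 is set aside to keep the poles inside
    the segment.\<close>
  define n where "n = nat \<lfloor>(l - 2) / T\<rfloor>"
  define h where "h i = curtain_at M d {0..l} \<alpha> (1 + T * real i)" for i :: nat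
  have bound: "1 + T * real i + 1/2 < l" if "i < n" for i
  proof -
    have "real n \<le> (l - 2) / T"
      using that unfolding n_def by linarith
    then have "T * real n \<le> l - 2" using T by (simp add: field_simps)
    moreover have "T * (real i + 1) \<le> T * real n"
      using that T by (intro mult_left_mono) auto
    ultimately show ?thesis using T by (simp add: algebra_simps)
  qed
  have dual: "dual_at M d (h i) {0..l} \<alpha> (1 + T * real i)" if i: "i < n" for i
  proof -
    have "0 \<le> T * real i" using T by simp
    then show ?thesis using \<alpha>(1) bound[OF i] unfolding dual_at_def h_def by auto
  qed
  have gap: "(1 + T * real i) + T \<le> 1 + T * real j" if "i < j" for i j :: nat
  proof -
    have "T * (real i + 1) \<le> T * real j" using that T by (intro mult_left_mono) auto
    then show ?thesis by (simp add: algebra_simps)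
  qed
  have gap1: "(1 + T * real i) + 1 < 1 + T * real j" if "i < j" for i j :: nat
    using gap[OF that] T by linarith
  note chain = dual_curtain_chain(1,2)[of n h "{0..l}" \<alpha> "\<lambda>i. 1 + T * real i", OF dual gap1]
  have sep: "L_separated M d L (h i) (h j)" if "i < j" "j < n" for i j
  proof -
    have "i < n" using that by simp
    then show ?thesis
      using far_dual_curtains_L_separated[OF \<delta> dual dual _ L] gap[OF that(1)] that(2)
      unfolding T_def by blast
  qed
  have "L_chain M d L (h ` {..<n})"
    unfolding L_chain_def pairwise_def
  proof (intro conjI ballI impI chain(1))
    fix a b assume "a \<in> h ` {..<n}" "b \<in> h ` {..<n}" "a \<noteq> b"
    then obtain i j where ij: "i < n" "j < n" "a = h i" "b = h j" by auto
    then have "i < j \<or> j < i" using \<open>a \<noteq> b\<close> by (metis linorder_neqE_nat)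
    then show "L_separated M d L a b"
      using sep[of i j] L_separated_commute[OF sep[of j i]] ij by blast
  qed
  moreover have "chain_separates M d (h ` {..<n}) {x} {y}"
    unfolding chain_separates_def separates_iff
  proof (rule ballI)
    fix a assume "a \<in> h ` {..<n}"
    then obtain i where i: "i < n" "a = h i" by auto
    let ?N = "halfspace_minus M d {0..l} \<alpha> (1 + T * real i)"
    let ?P = "halfspace_plus M d {0..l} \<alpha> (1 + T * real i)"
    have ends: "foot {0..l} \<alpha> x = 0" "foot {0..l} \<alpha> y = l"
      using foot_on_geodesic[OF I, of 0] foot_on_geodesic[OF I, of l] l0 unfolding \<alpha>(2,3) by auto
    have "0 \<le> T * real i" using T by simp
    then have "x \<in> ?N" "y \<in> ?P"
      unfolding dual_at_foot(2)[OF dual[OF i(1)]] dual_at_foot(3)[OF dual[OF i(1)]]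
      using ends xy bound[OF i(1)] by auto
    moreover have "sides a ?N ?P" unfolding sides_def i(2) using dual[OF i(1)] by blast
    ultimately show "\<exists>N P. sides a N P \<and> {x} \<subseteq> N \<and> {y} \<subseteq> P" by blast
  qed
  ultimately have "1 + real n \<le> dist_L M d L x y"
    using dist_L_attained(2)[OF xy False, of L "h ` {..<n}"] chain(2) by simp
  moreover have "(l - 2) / T - 1 \<le> real n"
    unfolding n_def by linarith
  moreover have "(l - 2) / T = l / T - 2 / T" "2 / T \<le> 1"
    using T by (auto simp: diff_divide_distrib)
  ultimately show ?thesis unfolding l_def T_def by linarith
qed

end

section \<open>Comparison of the metrics\<close>

lemma quasi_isometry_idI:
  assumes K: "1 \<le> K" "0 \<le> C"
    and le: "\<And>x y. x \<in> M \<Longrightarrow> y \<in> M \<Longrightarrow> d x y \<le> K * (e x y + C) \<and> e x y \<le> K * d x y + C"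
    and e: "\<And>x. x \<in> M \<Longrightarrow> e x x \<le> C"
  shows "quasi_isometry M d M e id"
  unfolding quasi_isometry_def
proof (intro conjI exI ballI)
  show "1 \<le> K" "0 \<le> C" using K by auto
  show "d x y / K - C \<le> e (id x) (id y)" if "x \<in> M" "y \<in> M" for x y
    using le[OF that] K(1) by (simp add: field_simps)
  show "e (id x) (id y) \<le> K * d x y + C" if "x \<in> M" "y \<in> M" for x y
    using le[OF that] by simp
  show "\<exists>x\<in>M. e (id x) z \<le> C" if "z \<in> M" for z
    using e[OF that] that by auto
qed simp

lemma weights_summable:
  assumes "curtain_weights lam"
  shows "summable (\<lambda>n. lam (Suc n))" "0 < lam (Suc n)"
proof -
  have pos: "0 < lam (Suc n)" for n
    using assms unfolding curtain_weights_def by simp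
  show "0 < lam (Suc n)" by (rule pos)
  show "summable (\<lambda>n. lam (Suc n))"
  proof (rule summable_comparison_test')
    show "summable (\<lambda>n. real (Suc n) ^ 2 * lam (Suc n))"
      using assms unfolding curtain_weights_def by blast
    fix n :: nat
    have "1 * lam (Suc n) \<le> real (Suc n) ^ 2 * lam (Suc n)"
      using pos[of n] by (intro mult_right_mono) (auto intro!: one_le_power)
    then show "norm (lam (Suc n)) \<le> real (Suc n) ^ 2 * lam (Suc n)"
      using pos[of n] by simp
  qed
qed

context CAT0_space
begin

text \<open>
  The upper bound holds because \<open>d\<^sub>L \<le> d + 2\<close> uniformly in \<open>L\<close>, the lower bound because a series of nonnegative
  terms dominates each of them.
\<close>

lemma curtain_model_dist_bounds:
  assumes lam: "curtain_weights lam" and xy: "x \<in> M" "y \<in> M"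
  shows "curtain_model_dist M d lam x y \<le> (\<Sum>n. lam (Suc n)) * (d x y + 2)"
    and "lam (Suc n) * dist_L M d (Suc n) x y \<le> curtain_model_dist M d lam x y"
proof -
  note pos = weights_summable(2)[OF lam]
  have b: "0 \<le> lam (Suc n) * dist_L M d (Suc n) x y"
    "lam (Suc n) * dist_L M d (Suc n) x y \<le> lam (Suc n) * (d x y + 2)" for n
    using dist_L_bounds[OF xy] pos[of n] by (auto intro: mult_left_mono)
  have s: "summable (\<lambda>n. lam (Suc n) * (d x y + 2))"
    by (rule summable_mult2[OF weights_summable(1)[OF lam]])
  have s': "summable (\<lambda>n. lam (Suc n) * dist_L M d (Suc n) x y)"
    by (rule summable_comparison_test'[OF s]) (use b in auto)
  show "curtain_model_dist M d lam x y \<le> (\<Sum>n. lam (Suc n)) * (d x y + 2)"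
    unfolding curtain_model_dist_def suminf_mult2[OF weights_summable(1)[OF lam]]
    by (rule suminf_le[OF b(2) s' s])
  have "(\<Sum>k\<in>{n}. lam (Suc k) * dist_L M d (Suc k) x y) \<le> curtain_model_dist M d lam x y"
    unfolding curtain_model_dist_def by (rule sum_le_suminf[OF s']) (use b(1) in auto)
  then show "lam (Suc n) * dist_L M d (Suc n) x y \<le> curtain_model_dist M d lam x y" by simp
qed

lemma curtain_model_dist_self: "curtain_model_dist M d lam x x = 0"
  unfolding curtain_model_dist_def dist_L_self by simp

text \<open>
  Each of \<open>d\<^sub>L\<close>, for \<open>L \<ge> L\<^sub>0\<close>, and \<open>D\<close> is comparable to \<open>d\<close>: from above always, from below by
  hyperbolicity. For \<open>D\<close> the lower bound comes from the single term with index \<open>L\<^sub>0 + 1\<close>, which is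
  at least 1 as the weights require.
\<close>

lemma hyperbolic_imp_quasi_isometries:
  assumes hyp: "hyperbolic_space M d" and lam: "curtain_weights lam"
  shows "\<exists>L\<^sub>0::nat. \<forall>L\<ge>L\<^sub>0.
       quasi_isometry M d M (dist_L M d L) id \<and>
       quasi_isometry M d M (curtain_model_dist M d lam) id \<and>
       quasi_isometry M (dist_L M d L) M (curtain_model_dist M d lam) id"
proof -
  obtain \<delta> where \<delta>: "slim_triangles \<delta>" "0 \<le> \<delta>" using hyp unfolding hyperbolic_space_iff by blast
  define L0 where "L0 = nat \<lceil>8 * \<delta> + 5\<rceil>"
  define T where "T = 8 * \<delta> + 2"
  have T: "2 \<le> T" using \<delta>(2) by (simp add: T_def)
  have L0: "8 * \<delta> + 5 \<le> real L0" unfolding L0_def by linarith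
  define s w where "s = (\<Sum>n. lam (Suc n))" and "w = lam (Suc L0)"
  note pos = weights_summable(2)[OF lam]
  have s: "0 \<le> s" unfolding s_def
    by (rule suminf_nonneg[OF weights_summable(1)[OF lam]]) (simp add: less_imp_le[OF pos])
  have w: "0 < w" unfolding w_def by (rule pos)
  let ?D = "curtain_model_dist M d lam"
  have dL: "d x y \<le> T * (dist_L M d L x y + 1)" if "L0 \<le> L" "x \<in> M" "y \<in> M" for L x y
  proof -
    have "8 * \<delta> + 5 \<le> real L" using L0 that(1) by linarith
    then have "d x y / T - 1 \<le> dist_L M d L x y"
      using dist_L_lower_bound[OF \<delta> _ that(2,3)] unfolding T_def by blast
    then show ?thesis using T by (simp add: field_simps)
  qed
  have dD: "d x y \<le> T / w * (?D x y + w)" if xy: "x \<in> M" "y \<in> M" for x y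
  proof -
    have "dist_L M d (Suc L0) x y \<le> ?D x y / w"
      using curtain_model_dist_bounds(2)[OF lam xy, of L0] w unfolding w_def by (simp add: field_simps)
    then have "T * (dist_L M d (Suc L0) x y + 1) \<le> T * (?D x y / w + 1)"
      using T by (intro mult_left_mono) auto
    also have "\<dots> = T / w * (?D x y + w)" using w by (simp add: field_simps)
    finally show ?thesis using dL[OF _ xy, of "Suc L0"] by simp
  qed
  have Dd: "?D x y \<le> s * (d x y + 2)" if "x \<in> M" "y \<in> M" for x y
    unfolding s_def by (rule curtain_model_dist_bounds(1)[OF lam that])
  have nonneg_D: "0 \<le> ?D x y" if xy: "x \<in> M" "y \<in> M" for x y
  proof -
    have "0 \<le> lam (Suc L0) * dist_L M d (Suc L0) x y"
      using dist_L_bounds(1)[OF xy] pos[of L0] by simp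
    then show ?thesis using curtain_model_dist_bounds(2)[OF lam xy, of L0] by linarith
  qed
  show ?thesis
  proof (intro exI[of _ L0] allI impI conjI)
    fix L assume L: "L0 \<le> L"
    show "quasi_isometry M d M (dist_L M d L) id"
    proof (rule quasi_isometry_idI[of T 2])
      fix x y assume xy: "x \<in> M" "y \<in> M"
      have "T * (dist_L M d L x y + 1) \<le> T * (dist_L M d L x y + 2)"
        using T by (intro mult_left_mono) auto
      moreover have "1 * d x y \<le> T * d x y"
        using T by (intro mult_right_mono) auto
      ultimately show "d x y \<le> T * (dist_L M d L x y + 2) \<and> dist_L M d L x y \<le> T * d x y + 2"
        using dL[OF L xy] dist_L_bounds(2)[OF xy, of L] by linarith
    qed (use T in \<open>auto simp: dist_L_self\<close>)
    show "quasi_isometry M d M ?D id"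
    proof (rule quasi_isometry_idI[of "1 + T / w + s" "w + 2 * s"])
      fix x y assume xy: "x \<in> M" "y \<in> M"
      have "T / w * (?D x y + w) \<le> (1 + T / w + s) * (?D x y + (w + 2 * s))"
        using T w s nonneg_D[OF xy] by (intro mult_mono) auto
      moreover have "s * d x y \<le> (1 + T / w + s) * d x y"
        using T w by (intro mult_right_mono) auto
      moreover have "s * (d x y + 2) = s * d x y + 2 * s" by (simp add: algebra_simps)
      ultimately show "d x y \<le> (1 + T / w + s) * (?D x y + (w + 2 * s)) \<and>
          ?D x y \<le> (1 + T / w + s) * d x y + (w + 2 * s)"
        using dD[OF xy] Dd[OF xy] w by linarith
    qed (use T w s in \<open>auto simp: curtain_model_dist_self\<close>)
    show "quasi_isometry M (dist_L M d L) M ?D id"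
    proof (rule quasi_isometry_idI[of "1 + T / w + s * T" "w + 2 + s * (T + 2)"])
      fix x y assume xy: "x \<in> M" "y \<in> M"
      let ?e = "dist_L M d L x y"
      have e: "0 \<le> ?e" "?e \<le> d x y + 2" using dist_L_bounds[OF xy] by auto
      have K: "1 \<le> 1 + T / w + s * T" "T / w \<le> 1 + T / w + s * T" "s * T \<le> 1 + T / w + s * T"
        using T w s by auto
      have "?e \<le> T / w * (?D x y + w) + 1 * 2" using e(2) dD[OF xy] by linarith
      also have "\<dots> \<le> (1 + T / w + s * T) * (?D x y + w) + (1 + T / w + s * T) * 2"
        using K nonneg_D[OF xy] w by (intro add_mono mult_right_mono) auto
      also have "\<dots> = (1 + T / w + s * T) * (?D x y + w + 2)" by (simp add: algebra_simps)
      also have "\<dots> \<le> (1 + T / w + s * T) * (?D x y + (w + 2 + s * (T + 2)))"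
        using K(1) T s by (intro mult_left_mono) auto
      finally have 1: "?e \<le> (1 + T / w + s * T) * (?D x y + (w + 2 + s * (T + 2)))" .
      have "?D x y \<le> s * (T * (?e + 1) + 2)"
        using Dd[OF xy] mult_left_mono[OF dL[OF L xy] s] by (simp add: algebra_simps)
      also have "\<dots> = s * T * ?e + s * (T + 2)" by (simp add: algebra_simps)
      also have "\<dots> \<le> (1 + T / w + s * T) * ?e + (w + 2 + s * (T + 2))"
        using mult_right_mono[OF K(3) e(1)] w by linarith
      finally show "?e \<le> (1 + T / w + s * T) * (?D x y + (w + 2 + s * (T + 2))) \<and>
          ?D x y \<le> (1 + T / w + s * T) * ?e + (w + 2 + s * (T + 2))"
        using 1 by blast
    qed (use T w s in \<open>auto simp: curtain_model_dist_self\<close>)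
  qed
qed

lemma quasi_isometry_imp_hyperbolic:
  assumes "quasi_isometry M d M (dist_L M d L) id"
  shows "hyperbolic_space M d"
proof -
  obtain K C where K: "1 \<le> K" "0 \<le> C"
    and qi: "\<forall>x\<in>M. \<forall>y\<in>M. d x y / K - C \<le> dist_L M d L (id x) (id y)
      \<and> dist_L M d L (id x) (id y) \<le> K * d x y + C"
    using assms unfolding quasi_isometry_def by blast
  show ?thesis
  proof (rule hyperbolic_if_dist_L_large[OF K(1)])
    show "0 \<le> K * C" using K by simp
    fix x y assume "x \<in> M" "y \<in> M"
    then have "d x y / K - C \<le> dist_L M d L x y" using qi by simp
    then show "d x y \<le> K * dist_L M d L x y + K * C" using K(1) by (simp add: field_simps)
  qed
qed

end

theorem theorem13:
  fixes M :: "'a set" and d :: "'a \<Rightarrow> 'a \<Rightarrow> real" and lam :: "nat \<Rightarrow> real"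
  assumes "CAT0 M d" and "curtain_weights lam"
  shows "hyperbolic_space M d \<longleftrightarrow>
    (\<exists>L\<^sub>0::nat. \<forall>L\<ge>L\<^sub>0.
       quasi_isometry M d M (dist_L M d L) id \<and>
       quasi_isometry M d M (curtain_model_dist M d lam) id \<and>
       quasi_isometry M (dist_L M d L) M (curtain_model_dist M d lam) id)"
proof -
  interpret CAT0_space M d using assms(1) by (rule CAT0_space.intro)
  show ?thesis
  proof
    assume "hyperbolic_space M d"
    then show "\<exists>L\<^sub>0::nat. \<forall>L\<ge>L\<^sub>0.
       quasi_isometry M d M (dist_L M d L) id \<and>
       quasi_isometry M d M (curtain_model_dist M d lam) id \<and>
       quasi_isometry M (dist_L M d L) M (curtain_model_dist M d lam) id"
      using assms(2) by (rule hyperbolic_imp_quasi_isometries)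
  next
    assume "\<exists>L\<^sub>0::nat. \<forall>L\<ge>L\<^sub>0.
       quasi_isometry M d M (dist_L M d L) id \<and>
       quasi_isometry M d M (curtain_model_dist M d lam) id \<and>
       quasi_isometry M (dist_L M d L) M (curtain_model_dist M d lam) id"
    then show "hyperbolic_space M d" using quasi_isometry_imp_hyperbolic by blast
  qed
qed

end
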